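(* Let $(\mathcal{C},\mathbb{E},\mathfrak{s})$ be a weakly idempotent complete extriangulated category. Then the assignments $$(\mathcal{U},\mathcal{V})\mapsto(\mathrm{Infl}\,\mathcal{U},\mathrm{Defl}\,\mathcal{V})\qquad\text{and}\qquad(\mathcal{L},\mathcal{R})\mapsto(\mathrm{Cone}(\mathcal{L}),\mathrm{CoCone}(\mathcal{R}))$$ give mutually inverse bijections between the following classes: (1) cotorsion pairs $(\mathcal{U},\mathcal{V})$ on $\mathcal{C}$; (2) admissible weak factorization systems $(\mathcal{L},\mathcal{R})$ in $\mathcal{C}$.
   Context: **Extriangulated categories (Nakaoka–Palu).** Let $\mathcal{C}$ be an additive category and $\mathbb{E}:\mathcal{C}^{\rm op}\times\mathcal{C}\to\mathrm{Ab}$ an additive bifunctor; elements $\delta\in\mathbb{E}(C,A)$ are called $\mathbb{E}$-extensions. For $a:A\to A'$, $c:C'\to C$ write $a_*\delta=\mathbb{E}(C,a)(\delta)$ and $c^*\delta=\mathbb{E}(c,A)(\delta)$. A morphism from $\delta\in\mathbb{E}(C,A)$ to $\delta'\in\mathbb{E}(C',A')$ is a pair $(a:A\to A',\,c:C\to C')$ with $a_*\delta=c^*\delta'$. Sequences $A\xrightarrow{x}B\xrightarrow{y}C$ and $A\xrightarrow{x'}B'\xrightarrow{y'}C$ are equivalent if there is an isomorphism $b:B\to B'$ with $bx=x'$, $y'b=y$. A realization $\mathfrak{s}$ assigns to each $\delta\in\mathbb{E}(C,A)$ an equivalence class $\mathfrak{s}(\delta)=[A\xrightarrow{x}B\xrightarrow{y}C]$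 such that for every morphism $(a,c):\delta\to\delta'$ with $\mathfrak{s}(\delta')=[A'\xrightarrow{x'}B'\xrightarrow{y'}C']$ there is $b:B\to B'$ with $bx=x'a$ and $y'b=cy$. It is additive if $\mathfrak{s}(0)=[A\to A\oplus C\to C]$ (canonical maps) and $\mathfrak{s}(\delta\oplus\delta')=\mathfrak{s}(\delta)\oplus\mathfrak{s}(\delta')$. The triple $(\mathcal{C},\mathbb{E},\mathfrak{s})$ is an extriangulated category if $\mathfrak{s}$ is an additive realization and: (ET3) if $\delta,\delta'$ are realized by $A\xrightarrow{x}B\xrightarrow{y}C$ and $A'\xrightarrow{x'}B'\xrightarrow{y'}C'$ and $bx=x'a$, there is $c:C\to C'$ with $cy=y'b$ and $a_*\delta=c^*\delta'$; (ET3)$^{\rm op}$ dually, if $cy=y'b$, there is $a$ with $bx=x'a$ and $a_*\delta=c^*\delta'$; (ET4) if $\delta\in\mathbb{E}(D,A)$ is realized by $A\xrightarrow{f}B\xrightarrow{f'}D$ and $\delta'\in\mathbb{E}(F,B)$ by $B\xrightarrow{g}C\xrightarrow{g'}F$, there are an object $E$, morphisms $d:D\to E$, $e:E\to F$, $h=gf:A\to C$, $h':C\to E$ with $h'g=df'$, $eh'=g'$, and $\delta''\in\mathbb{E}(E,A)$ realized by $A\xrightarrow{h}C\xrightarrow{h'}E$ such that $D\xrightarrow{d}E\xrightarrow{e}F$ realizes $f'_*\delta'$, $d^*\delta''=\delta$, and $f_*\delta''=e^*\delta'$; (ET4)$^{\rm op}$ the dual of (ET4). A sequence $A\xrightarrow{x}B\xrightarrow{y}C$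 realizing some $\delta\in\mathbb{E}(C,A)$ is called a conflation (and, together with $\delta$, an $\mathbb{E}$-triangle); $x$ is called an inflation, $y$ a deflation, $\mathrm{Cone}(x):=C$ and $\mathrm{CoCone}(y):=A$ (well defined up to isomorphism). **Weakly idempotent complete** means that every split monomorphism has a cokernel; for an extriangulated category this is equivalent to Condition (WIC): for composable $f,g$, if $gf$ is an inflation then so is $f$, and if $gf$ is a deflation then so is $g$. **Weak factorization systems.** For $l:A\to B$ and $r:C\to D$, write $l\,\Box\,r$ if for all $f:A\to C$, $g:B\to D$ with $rf=gl$ there is $t:B\to C$ with $tl=f$, $rt=g$. For a class $\mathcal{M}$ of morphisms, $\mathcal{M}^{\Box}$ is the class of $r$ with $l\,\Box\,r$ for all $l\in\mathcal{M}$, and ${}^{\Box}\mathcal{M}$ is the class of $l$ with $l\,\Box\,r$ for all $r\in\mathcal{M}$. A pair $(\mathcal{L},\mathcal{R})$ of classes of morphisms is a weak factorization system if $\mathcal{L}^{\Box}=\mathcal{R}$, ${}^{\Box}\mathcal{R}=\mathcal{L}$, and every morphism $h$ factors as $h=gf$ with $f\in\mathcal{L}$, $g\in\mathcal{R}$. It is admissible if for every morphism $f$: (1) $f\in\mathcal{L}$ iff $f$ is an inflation and $0\to\mathrm{Cone}(f)$ belongs to $\mathcal{L}$; (2) $f\in\mathcal{R}$ iff $f$ is a deflation and $\mathrm{CoCone}(f)\to0$ belongs to $\mathcal{R}$. **Notation.** $\mathrm{Infl}\,\mathcal{X}$ is the class of inflations $f$ with $\mathrm{Cone}(f)\in\mathcal{X}$,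 and $\mathrm{Defl}\,\mathcal{X}$ the class of deflations $f$ with $\mathrm{CoCone}(f)\in\mathcal{X}$. For a class $\mathcal{L}$ of inflations, $\mathrm{Cone}(\mathcal{L})$ is the class of objects isomorphic to $\mathrm{Cone}(f)$ for some $f\in\mathcal{L}$; for a class $\mathcal{R}$ of deflations, $\mathrm{CoCone}(\mathcal{R})$ is the class of objects isomorphic to $\mathrm{CoCone}(f)$ for some $f\in\mathcal{R}$. **Cotorsion pairs.** A cotorsion pair on $\mathcal{C}$ is a pair $(\mathcal{U},\mathcal{V})$ of full additive subcategories closed under isomorphisms and direct summands such that $\mathbb{E}(U,V)=0$ for all $U\in\mathcal{U}$, $V\in\mathcal{V}$, and for every $C\in\mathcal{C}$ there are conflations $V^C\to U^C\to C$ and $C\to V_C\to U_C$ with $U^C,U_C\in\mathcal{U}$ and $V^C,V_C\in\mathcal{V}$. *)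

theory Defs
  imports "HOL-Algebra.Group"
begin

section \<open>Additive categories\<close>

text \<open>
  Objects and morphisms form sets. A morphism determines its source and target, so that a class of
  morphisms is a set of morphisms and a full subcategory is a set of objects. Only the values of
  the operations on the indicated carriers are relevant.
\<close>

record ('o, 'm) precategory =
  obj :: "'o set"
  arr :: "'m set"
  src :: "'m \<Rightarrow> 'o"
  tgt :: "'m \<Rightarrow> 'o"
  ident :: "'o \<Rightarrow> 'm"
  cmp :: "'m \<Rightarrow> 'm \<Rightarrow> 'm" (infixl "\<cdot>\<index>" 70)

record ('o, 'm) preadditive = "('o, 'm) precategory" +
  plus_mor :: "'m \<Rightarrow> 'm \<Rightarrow> 'm" (infixl "\<boxplus>\<index>" 65)
  zero_mor :: "'o \<Rightarrow> 'o \<Rightarrow> 'm"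

definition mor :: "('o, 'm, 'z) precategory_scheme \<Rightarrow> 'o \<Rightarrow> 'o \<Rightarrow> 'm set" where
  "mor C A B = {f \<in> arr C. src C f = A \<and> tgt C f = B}"

definition iso_mor :: "('o, 'm, 'z) precategory_scheme \<Rightarrow> 'm \<Rightarrow> bool" where
  "iso_mor C f \<longleftrightarrow> f \<in> arr C \<and>
     (\<exists>g \<in> mor C (tgt C f) (src C f).
        g \<cdot> f = ident C (src C f) \<and> f \<cdot> g = ident C (tgt C f))"
  for C (structure)

definition isomorphic_obj :: "('o, 'm, 'z) precategory_scheme \<Rightarrow> 'o \<Rightarrow> 'o \<Rightarrow> bool" where
  "isomorphic_obj C A B \<longleftrightarrow> (\<exists>f \<in> mor C A B. iso_mor C f)"

definition zero_object :: "('o, 'm, 'z) precategory_scheme \<Rightarrow> 'o \<Rightarrow> bool" where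
  "zero_object C Z \<longleftrightarrow> Z \<in> obj C \<and>
     (\<forall>X \<in> obj C. (\<exists>!f. f \<in> mor C Z X) \<and> (\<exists>!f. f \<in> mor C X Z))"

definition mor_group :: "('o, 'm, 'z) preadditive_scheme \<Rightarrow> 'o \<Rightarrow> 'o \<Rightarrow> 'm monoid" where
  "mor_group C A B = \<lparr>carrier = mor C A B, mult = plus_mor C, one = zero_mor C A B\<rparr>"

definition biproduct ::
  "('o, 'm, 'z) preadditive_scheme \<Rightarrow> 'o \<Rightarrow> 'o \<Rightarrow> 'o \<Rightarrow> 'm \<Rightarrow> 'm \<Rightarrow> 'm \<Rightarrow> 'm \<Rightarrow> bool" where
  "biproduct C A B P i j p q \<longleftrightarrow>
     A \<in> obj C \<and> B \<in> obj C \<and> P \<in> obj C \<and>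
     i \<in> mor C A P \<and> j \<in> mor C B P \<and> p \<in> mor C P A \<and> q \<in> mor C P B \<and>
     p \<cdot> i = ident C A \<and> q \<cdot> j = ident C B \<and>
     q \<cdot> i = zero_mor C A B \<and> p \<cdot> j = zero_mor C B A \<and>
     (i \<cdot> p) \<boxplus> (j \<cdot> q) = ident C P"
  for C (structure)

locale category =
  fixes C :: "('o, 'm, 'z) precategory_scheme" (structure)
  assumes src_obj: "f \<in> arr C \<Longrightarrow> src C f \<in> obj C"
    and tgt_obj: "f \<in> arr C \<Longrightarrow> tgt C f \<in> obj C"
    and ident_mor: "A \<in> obj C \<Longrightarrow> ident C A \<in> mor C A A"
    and cmp_mor: "\<lbrakk>f \<in> mor C A B; g \<in> mor C B D\<rbrakk> \<Longrightarrow> g \<cdot> f \<in> mor C A D"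
    and cmp_ident_right: "f \<in> mor C A B \<Longrightarrow> f \<cdot> ident C A = f"
    and cmp_ident_left: "f \<in> mor C A B \<Longrightarrow> ident C B \<cdot> f = f"
    and cmp_assoc: "\<lbrakk>f \<in> mor C A B; g \<in> mor C B D; h \<in> mor C D E\<rbrakk>
      \<Longrightarrow> (h \<cdot> g) \<cdot> f = h \<cdot> (g \<cdot> f)"

locale additive_category = category C
  for C :: "('o, 'm, 'z) preadditive_scheme" (structure) +
  assumes mor_comm_group: "\<lbrakk>A \<in> obj C; B \<in> obj C\<rbrakk> \<Longrightarrow> comm_group (mor_group C A B)"
    and cmp_plus_right: "\<lbrakk>f \<in> mor C A B; f' \<in> mor C A B; g \<in> mor C B D\<rbrakk>
      \<Longrightarrow> g \<cdot> (f \<boxplus> f') = (g \<cdot> f) \<boxplus> (g \<cdot> f')"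
    and cmp_plus_left: "\<lbrakk>f \<in> mor C A B; g \<in> mor C B D; g' \<in> mor C B D\<rbrakk>
      \<Longrightarrow> (g \<boxplus> g') \<cdot> f = (g \<cdot> f) \<boxplus> (g' \<cdot> f)"
    and ex_zero_object: "\<exists>Z. zero_object C Z"
    and ex_biproduct: "\<lbrakk>A \<in> obj C; B \<in> obj C\<rbrakk> \<Longrightarrow> \<exists>P i j p q. biproduct C A B P i j p q"

text \<open>A split monomorphism is a morphism with a left inverse.\<close>

definition split_mono :: "('o, 'm, 'z) precategory_scheme \<Rightarrow> 'm \<Rightarrow> bool" where
  "split_mono C f \<longleftrightarrow> f \<in> arr C \<and>
     (\<exists>r \<in> mor C (tgt C f) (src C f). r \<cdot> f = ident C (src C f))"
  for C (structure)

definition is_cokernel :: "('o, 'm, 'z) preadditive_scheme \<Rightarrow> 'm \<Rightarrow> 'm \<Rightarrow> bool" where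
  "is_cokernel C f k \<longleftrightarrow> f \<in> arr C \<and> k \<in> arr C \<and> src C k = tgt C f \<and>
     k \<cdot> f = zero_mor C (src C f) (tgt C k) \<and>
     (\<forall>X \<in> obj C. \<forall>g \<in> mor C (tgt C f) X. g \<cdot> f = zero_mor C (src C f) X \<longrightarrow>
        (\<exists>!u. u \<in> mor C (tgt C k) X \<and> u \<cdot> k = g))"
  for C (structure)

definition weakly_idempotent_complete :: "('o, 'm, 'z) preadditive_scheme \<Rightarrow> bool" where
  "weakly_idempotent_complete C \<longleftrightarrow> (\<forall>f. split_mono C f \<longrightarrow> (\<exists>k. is_cokernel C f k))"


section \<open>Extriangulated categories\<close>

text \<open>
  The argument order follows \<open>E(D, A)\<close> with the contravariant object first. The abelian group
  \<open>E(D, A)\<close> is \<open>Ext C D A\<close>, a group in the sense of HOL-Algebra and hence written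
  multiplicatively: \<open>\<otimes>\<close> is its addition and \<open>\<one>\<close> is the zero extension. The homomorphism
  \<open>E(c, a)\<close> is \<open>Emap C c a\<close>, and \<open>s(\<delta>)\<close> for \<open>\<delta>\<close> in \<open>E(D, A)\<close> is the equivalence class
  \<open>rz C D A \<delta>\<close> of sequences; a sequence is given by its two morphisms.
\<close>

record ('o, 'm, 'e) extri = "('o, 'm) preadditive" +
  Ext :: "'o \<Rightarrow> 'o \<Rightarrow> 'e monoid"
  Emap :: "'m \<Rightarrow> 'm \<Rightarrow> 'e \<Rightarrow> 'e"
  rz :: "'o \<Rightarrow> 'o \<Rightarrow> 'e \<Rightarrow> ('m \<times> 'm) set"

text \<open>\<open>push C D a \<delta>\<close> is \<open>a\<^sub>*\<delta>\<close> for \<open>\<delta>\<close> over \<open>D\<close>, and \<open>pull C A c \<delta>\<close> is \<open>c\<^sup>*\<delta>\<close> for \<open>\<delta>\<close> under \<open>A\<close>.\<close>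

definition push :: "('o, 'm, 'e, 'z) extri_scheme \<Rightarrow> 'o \<Rightarrow> 'm \<Rightarrow> 'e \<Rightarrow> 'e" where
  "push C D a \<delta> = Emap C (ident C D) a \<delta>"

definition pull :: "('o, 'm, 'e, 'z) extri_scheme \<Rightarrow> 'o \<Rightarrow> 'm \<Rightarrow> 'e \<Rightarrow> 'e" where
  "pull C A c \<delta> = Emap C c (ident C A) \<delta>"

definition seqs :: "('o, 'm, 'z) precategory_scheme \<Rightarrow> 'o \<Rightarrow> 'o \<Rightarrow> ('m \<times> 'm) set" where
  "seqs C D A = {(x, y). x \<in> arr C \<and> y \<in> arr C \<and> src C x = A \<and> tgt C x = src C y \<and> tgt C y = D}"

definition seq_rel ::
  "('o, 'm, 'z) precategory_scheme \<Rightarrow> 'o \<Rightarrow> 'o \<Rightarrow> (('m \<times> 'm) \<times> ('m \<times> 'm)) set" where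
  "seq_rel C D A = {((x, y), (x', y')). (x, y) \<in> seqs C D A \<and> (x', y') \<in> seqs C D A \<and>
     (\<exists>b \<in> mor C (tgt C x) (tgt C x'). iso_mor C b \<and> b \<cdot> x = x' \<and> y' \<cdot> b = y)}"
  for C (structure)

definition realizes :: "('o, 'm, 'e, 'z) extri_scheme \<Rightarrow> 'm \<Rightarrow> 'm \<Rightarrow> 'o \<Rightarrow> 'o \<Rightarrow> 'e \<Rightarrow> bool" where
  "realizes C x y D A \<delta> \<longleftrightarrow> D \<in> obj C \<and> A \<in> obj C \<and> \<delta> \<in> carrier (Ext C D A) \<and> (x, y) \<in> rz C D A \<delta>"

text \<open>
  \<open>\<delta> \<oplus> \<delta>'\<close> in \<open>E(D \<oplus> D', A \<oplus> A')\<close> is the element corresponding to \<open>(\<delta>, 0, 0, \<delta>')\<close> under the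
  additivity of \<open>E\<close>. Here \<open>i, i'\<close> are the inclusions of \<open>A, A'\<close> into \<open>PA\<close>, and \<open>p, p'\<close> are the
  projections of \<open>PD\<close> onto \<open>D, D'\<close>.
\<close>

definition ext_sum ::
  "('o, 'm, 'e, 'z) extri_scheme \<Rightarrow> 'o \<Rightarrow> 'o \<Rightarrow> 'm \<Rightarrow> 'm \<Rightarrow> 'm \<Rightarrow> 'm \<Rightarrow> 'e \<Rightarrow> 'e \<Rightarrow> 'e" where
  "ext_sum C PD PA p p' i i' \<delta> \<delta>' =
     Emap C p i \<delta> \<otimes>\<^bsub>Ext C PD PA\<^esub> Emap C p' i' \<delta>'"

text \<open>
  \<open>f \<oplus> f'\<close>, where \<open>p, p'\<close> are the projections of the source and \<open>i, i'\<close> the inclusions into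
  the target.
\<close>

definition mor_sum ::
  "('o, 'm, 'z) preadditive_scheme \<Rightarrow> 'm \<Rightarrow> 'm \<Rightarrow> 'm \<Rightarrow> 'm \<Rightarrow> 'm \<Rightarrow> 'm \<Rightarrow> 'm" where
  "mor_sum C p p' i i' f f' = (i \<cdot> f \<cdot> p) \<boxplus> (i' \<cdot> f' \<cdot> p')"
  for C (structure)

locale extriangulated_category = additive_category C
  for C :: "('o, 'm, 'e, 'z) extri_scheme" (structure) +
  assumes Ext_comm_group: "\<lbrakk>D \<in> obj C; A \<in> obj C\<rbrakk> \<Longrightarrow> comm_group (Ext C D A)"
    and Emap_hom: "\<lbrakk>c \<in> mor C D' D; a \<in> mor C A A'\<rbrakk>
      \<Longrightarrow> Emap C c a \<in> hom (Ext C D A) (Ext C D' A')"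
    and Emap_ident: "\<lbrakk>D \<in> obj C; A \<in> obj C; \<delta> \<in> carrier (Ext C D A)\<rbrakk>
      \<Longrightarrow> Emap C (ident C D) (ident C A) \<delta> = \<delta>"
    and Emap_cmp: "\<lbrakk>c \<in> mor C D' D; c' \<in> mor C D'' D'; a \<in> mor C A A'; a' \<in> mor C A' A'';
        \<delta> \<in> carrier (Ext C D A)\<rbrakk>
      \<Longrightarrow> Emap C (c \<cdot> c') (a' \<cdot> a) \<delta> = Emap C c' a' (Emap C c a \<delta>)"
    and push_plus: "\<lbrakk>D \<in> obj C; a \<in> mor C A A'; a' \<in> mor C A A'; \<delta> \<in> carrier (Ext C D A)\<rbrakk>
      \<Longrightarrow> push C D (a \<boxplus> a') \<delta> = push C D a \<delta> \<otimes>\<^bsub>Ext C D A'\<^esub> push C D a' \<delta>"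
    and pull_plus: "\<lbrakk>A \<in> obj C; c \<in> mor C D' D; c' \<in> mor C D' D; \<delta> \<in> carrier (Ext C D A)\<rbrakk>
      \<Longrightarrow> pull C A (c \<boxplus> c') \<delta> = pull C A c \<delta> \<otimes>\<^bsub>Ext C D' A\<^esub> pull C A c' \<delta>"

    and rz_class: "\<lbrakk>D \<in> obj C; A \<in> obj C; \<delta> \<in> carrier (Ext C D A)\<rbrakk>
      \<Longrightarrow> rz C D A \<delta> \<in> seqs C D A // seq_rel C D A"
    and rz_morphism: "\<lbrakk>realizes C x y D A \<delta>; realizes C x' y' D' A' \<delta>';
        a \<in> mor C A A'; c \<in> mor C D D'; push C D a \<delta> = pull C A' c \<delta>'\<rbrakk>
      \<Longrightarrow> \<exists>b \<in> mor C (tgt C x) (tgt C x'). b \<cdot> x = x' \<cdot> a \<and> y' \<cdot> b = c \<cdot> y"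
    and rz_zero: "biproduct C A D P i j p q \<Longrightarrow> realizes C i q D A \<one>\<^bsub>Ext C D A\<^esub>"
    and rz_sum: "\<lbrakk>realizes C x y D A \<delta>; realizes C x' y' D' A' \<delta>';
        biproduct C A A' PA iA iA' pA pA';
        biproduct C (tgt C x) (tgt C x') PB iB iB' pB pB';
        biproduct C D D' PD iD iD' pD pD'\<rbrakk>
      \<Longrightarrow> realizes C (mor_sum C pA pA' iB iB' x x') (mor_sum C pB pB' iD iD' y y')
            PD PA (ext_sum C PD PA pD pD' iA iA' \<delta> \<delta>')"

    and ET3: "\<lbrakk>realizes C x y D A \<delta>; realizes C x' y' D' A' \<delta>';
        a \<in> mor C A A'; b \<in> mor C (tgt C x) (tgt C x'); b \<cdot> x = x' \<cdot> a\<rbrakk>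
      \<Longrightarrow> \<exists>c \<in> mor C D D'. c \<cdot> y = y' \<cdot> b \<and> push C D a \<delta> = pull C A' c \<delta>'"
    and ET3_op: "\<lbrakk>realizes C x y D A \<delta>; realizes C x' y' D' A' \<delta>';
        b \<in> mor C (tgt C x) (tgt C x'); c \<in> mor C D D'; c \<cdot> y = y' \<cdot> b\<rbrakk>
      \<Longrightarrow> \<exists>a \<in> mor C A A'. b \<cdot> x = x' \<cdot> a \<and> push C D a \<delta> = pull C A' c \<delta>'"

    and ET4: "\<lbrakk>realizes C f f' D A \<delta>; realizes C g g' F B \<delta>'; tgt C f = B\<rbrakk>
      \<Longrightarrow> \<exists>E \<in> obj C. \<exists>d \<in> mor C D E. \<exists>e \<in> mor C E F. \<exists>h' \<in> mor C (tgt C g) E.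
            \<exists>\<delta>'' \<in> carrier (Ext C E A).
              h' \<cdot> g = d \<cdot> f' \<and> e \<cdot> h' = g' \<and>
              realizes C (g \<cdot> f) h' E A \<delta>'' \<and>
              realizes C d e F D (push C F f' \<delta>') \<and>
              pull C A d \<delta>'' = \<delta> \<and>
              push C E f \<delta>'' = pull C B e \<delta>'"
    \<comment> \<open>Here \<open>D \<rightarrow> B \<rightarrow> A\<close> via \<open>f', f\<close> realizes \<open>\<delta>\<close>, and \<open>F \<rightarrow> G \<rightarrow> B\<close> via \<open>g', g\<close> realizes \<open>\<delta>'\<close>:
        all arrows of (ET4) are reversed and keep their names.\<close>
    and ET4_op: "\<lbrakk>realizes C f' f A D \<delta>; realizes C g' g B F \<delta>'; src C f = B\<rbrakk>
      \<Longrightarrow> \<exists>E \<in> obj C. \<exists>d \<in> mor C E D. \<exists>e \<in> mor C F E. \<exists>h' \<in> mor C E (src C g).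
            \<exists>\<delta>'' \<in> carrier (Ext C A E).
              g \<cdot> h' = f' \<cdot> d \<and> h' \<cdot> e = g' \<and>
              realizes C h' (f \<cdot> g) A E \<delta>'' \<and>
              realizes C e d D F (pull C F f' \<delta>') \<and>
              push C A d \<delta>'' = \<delta> \<and>
              pull C E f \<delta>'' = push C B e \<delta>'"

definition conflation :: "('o, 'm, 'e, 'z) extri_scheme \<Rightarrow> 'm \<Rightarrow> 'm \<Rightarrow> bool" where
  "conflation C x y \<longleftrightarrow> (\<exists>\<delta>. realizes C x y (tgt C y) (src C x) \<delta>)"

definition inflation :: "('o, 'm, 'e, 'z) extri_scheme \<Rightarrow> 'm \<Rightarrow> bool" where
  "inflation C x \<longleftrightarrow> (\<exists>y. conflation C x y)"

definition deflation :: "('o, 'm, 'e, 'z) extri_scheme \<Rightarrow> 'm \<Rightarrow> bool" where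
  "deflation C y \<longleftrightarrow> (\<exists>x. conflation C x y)"

text \<open>Cones and cocones are only determined up to isomorphism, hence given as relations.\<close>

definition is_Cone :: "('o, 'm, 'e, 'z) extri_scheme \<Rightarrow> 'm \<Rightarrow> 'o \<Rightarrow> bool" where
  "is_Cone C x D \<longleftrightarrow> (\<exists>y. conflation C x y \<and> tgt C y = D)"

definition is_CoCone :: "('o, 'm, 'e, 'z) extri_scheme \<Rightarrow> 'm \<Rightarrow> 'o \<Rightarrow> bool" where
  "is_CoCone C y A \<longleftrightarrow> (\<exists>x. conflation C x y \<and> src C x = A)"

definition Infl :: "('o, 'm, 'e, 'z) extri_scheme \<Rightarrow> 'o set \<Rightarrow> 'm set" where
  "Infl C X = {f \<in> arr C. inflation C f \<and> (\<exists>D. is_Cone C f D \<and> D \<in> X)}"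

definition Defl :: "('o, 'm, 'e, 'z) extri_scheme \<Rightarrow> 'o set \<Rightarrow> 'm set" where
  "Defl C X = {f \<in> arr C. deflation C f \<and> (\<exists>A. is_CoCone C f A \<and> A \<in> X)}"

definition Cone_class :: "('o, 'm, 'e, 'z) extri_scheme \<Rightarrow> 'm set \<Rightarrow> 'o set" where
  "Cone_class C L = {X \<in> obj C. \<exists>f \<in> L. \<exists>D. is_Cone C f D \<and> isomorphic_obj C X D}"

definition CoCone_class :: "('o, 'm, 'e, 'z) extri_scheme \<Rightarrow> 'm set \<Rightarrow> 'o set" where
  "CoCone_class C R = {X \<in> obj C. \<exists>f \<in> R. \<exists>A. is_CoCone C f A \<and> isomorphic_obj C X A}"


section \<open>Admissible weak factorization systems\<close>

definition lifts :: "('o, 'm, 'z) precategory_scheme \<Rightarrow> 'm \<Rightarrow> 'm \<Rightarrow> bool" where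
  "lifts C l r \<longleftrightarrow>
     (\<forall>f \<in> mor C (src C l) (src C r). \<forall>g \<in> mor C (tgt C l) (tgt C r). r \<cdot> f = g \<cdot> l \<longrightarrow>
        (\<exists>t \<in> mor C (tgt C l) (src C r). t \<cdot> l = f \<and> r \<cdot> t = g))"
  for C (structure)

definition right_lift :: "('o, 'm, 'z) precategory_scheme \<Rightarrow> 'm set \<Rightarrow> 'm set" where
  "right_lift C M = {r \<in> arr C. \<forall>l \<in> M. lifts C l r}"

definition left_lift :: "('o, 'm, 'z) precategory_scheme \<Rightarrow> 'm set \<Rightarrow> 'm set" where
  "left_lift C M = {l \<in> arr C. \<forall>r \<in> M. lifts C l r}"

definition weak_factorization_system ::
  "('o, 'm, 'z) precategory_scheme \<Rightarrow> 'm set \<Rightarrow> 'm set \<Rightarrow> bool" where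
  "weak_factorization_system C L R \<longleftrightarrow> L \<subseteq> arr C \<and> R \<subseteq> arr C \<and>
     right_lift C L = R \<and> left_lift C R = L \<and>
     (\<forall>h \<in> arr C. \<exists>f \<in> L. \<exists>g \<in> R. tgt C f = src C g \<and> h = g \<cdot> f)"
  for C (structure)

definition admissible_wfs :: "('o, 'm, 'e, 'z) extri_scheme \<Rightarrow> ('m set \<times> 'm set) set" where
  "admissible_wfs C = {(L, R). weak_factorization_system C L R \<and>
     (\<forall>f \<in> arr C.
        (f \<in> L \<longleftrightarrow> inflation C f \<and> (\<exists>Z D. zero_object C Z \<and> is_Cone C f D \<and> zero_mor C Z D \<in> L)) \<and>
        (f \<in> R \<longleftrightarrow> deflation C f \<and> (\<exists>Z A. zero_object C Z \<and> is_CoCone C f A \<and> zero_mor C A Z \<in> R)))}"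


section \<open>Cotorsion pairs\<close>

definition additive_subcategory :: "('o, 'm, 'z) preadditive_scheme \<Rightarrow> 'o set \<Rightarrow> bool" where
  "additive_subcategory C U \<longleftrightarrow> U \<subseteq> obj C \<and> (\<exists>Z \<in> U. zero_object C Z) \<and>
     (\<forall>A \<in> U. \<forall>B \<in> U. \<exists>P \<in> U. \<exists>i j p q. biproduct C A B P i j p q)"

definition iso_closed :: "('o, 'm, 'z) precategory_scheme \<Rightarrow> 'o set \<Rightarrow> bool" where
  "iso_closed C U \<longleftrightarrow> (\<forall>A \<in> U. \<forall>B \<in> obj C. isomorphic_obj C A B \<longrightarrow> B \<in> U)"

definition summand_closed :: "('o, 'm, 'z) preadditive_scheme \<Rightarrow> 'o set \<Rightarrow> bool" where
  "summand_closed C U \<longleftrightarrow> (\<forall>P \<in> U. \<forall>A B i j p q. biproduct C A B P i j p q \<longrightarrow> A \<in> U)"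

definition cotorsion_pairs :: "('o, 'm, 'e, 'z) extri_scheme \<Rightarrow> ('o set \<times> 'o set) set" where
  "cotorsion_pairs C = {(U, V).
     additive_subcategory C U \<and> iso_closed C U \<and> summand_closed C U \<and>
     additive_subcategory C V \<and> iso_closed C V \<and> summand_closed C V \<and>
     (\<forall>A \<in> U. \<forall>B \<in> V. carrier (Ext C A B) = {\<one>\<^bsub>Ext C A B\<^esub>}) \<and>
     (\<forall>X \<in> obj C.
        (\<exists>x y. conflation C x y \<and> src C x \<in> V \<and> tgt C x \<in> U \<and> tgt C y = X) \<and>
        (\<exists>x y. conflation C x y \<and> src C x = X \<and> tgt C x \<in> V \<and> tgt C y \<in> U))}"

end

theory Submission
  imports Defs
begin

text \<open>
  The two assignments undo each other for formal reasons. An object \<open>X\<close> is recovered from the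
  inflation \<open>0 \<rightarrow> X\<close>, whose cone is \<open>X\<close> (\<open>Cone_class_Infl\<close>), and an admissible class \<open>L\<close> is
  recovered from its cones because admissibility says that membership in \<open>L\<close> only depends on the
  cone (\<open>Infl_Cone_class\<close>). What needs proof is that each assignment lands in the other class.

  Let \<open>(U, V)\<close> be a cotorsion pair. In a square from \<open>f \<in> Infl U\<close> to \<open>g \<in> Defl V\<close>, the obstruction
  to lifting the lower edge along \<open>g\<close> and the obstruction to correcting the lift on the source of
  \<open>f\<close> are both governed by a group \<open>E(U, V)\<close>, which vanishes (\<open>lifts_inflation_deflation\<close>).
  To factor \<open>h : A \<rightarrow> B\<close>, take a conflation \<open>V' \<rightarrow> U' \<rightarrow> B\<close>. Then \<open>A \<oplus> U' \<rightarrow> B\<close> is a deflation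
  (\<open>deflation_row\<close>), with cocone \<open>W\<close> say. The pushout of \<open>W \<rightarrow> A \<oplus> U'\<close> along the inflation of a
  conflation \<open>W \<rightarrow> V'' \<rightarrow> U''\<close> gives \<open>A \<rightarrow> A \<oplus> U' \<rightarrow> M \<rightarrow> B\<close>, where \<open>M \<rightarrow> B\<close> has cocone \<open>V''\<close> and
  the cone of \<open>A \<rightarrow> M\<close> is an extension of \<open>U''\<close> by \<open>U'\<close>, hence lies in \<open>U\<close>
  (\<open>pushout_of_conflations\<close>, \<open>cotorsion_class_extension_closed\<close>, \<open>cotorsion_factorization\<close>).
  Finally, a morphism \<open>r\<close> with the right lifting property against \<open>Infl U\<close> is, by the retract
  argument, a retract of the second factor \<open>g\<close> in its own factorization. Weak idempotent
  completeness makes \<open>r\<close> a deflation whose cocone is a direct summand of that of \<open>g\<close>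
  (\<open>deflation_of_retract\<close>, \<open>right_lift_Infl\<close>).

  Let \<open>(L, R)\<close> be an admissible weak factorization system. The objects of \<open>Cone(L)\<close> are those
  that are projective relative to \<open>R\<close> (\<open>Cone_class_iff_relatively_projective\<close>), from which the
  closure properties follow. An extension of \<open>A \<in> Cone(L)\<close> by an object of \<open>CoCone(R)\<close> is realized
  by a deflation in \<open>R\<close>, which splits because \<open>A\<close> is relatively projective. Factoring \<open>0 \<rightarrow> X\<close>
  gives one of the two conflations of a cotorsion pair (\<open>admissible_wfs_resolution\<close>).

  All axioms are self-dual, so that only one half of each argument is carried out; the other half
  is the same statement in the opposite category (\<open>opposite_extriangulated\<close>).
\<close>

section \<open>Calculating in additive categories\<close>

text \<open>
  Unfolding hom-sets into equations for source and target lets the simplifier discharge the side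
  conditions of the rules below by rewriting.
\<close>

lemma mor_iff: "f \<in> mor C A B \<longleftrightarrow> f \<in> arr C \<and> src C f = A \<and> tgt C f = B"
  by (auto simp: mor_def)

context category
begin

lemma cmp_arr [simp]:
  assumes "f \<in> arr C" "g \<in> arr C" "src C g = tgt C f"
  shows "g \<cdot> f \<in> arr C" "src C (g \<cdot> f) = src C f" "tgt C (g \<cdot> f) = tgt C g"
  using cmp_mor[of f "src C f" "tgt C f" g "tgt C g"] assms by (auto simp: mor_iff)

lemma ident_arr [simp]:
  assumes "A \<in> obj C"
  shows "ident C A \<in> arr C" "src C (ident C A) = A" "tgt C (ident C A) = A"
  using ident_mor[OF assms] by (auto simp: mor_iff)

lemma src_in_obj [simp]: "f \<in> arr C \<Longrightarrow> src C f \<in> obj C"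
  and tgt_in_obj [simp]: "f \<in> arr C \<Longrightarrow> tgt C f \<in> obj C"
  by (rule src_obj tgt_obj; assumption)+

lemma cmp_id [simp]:
  "f \<in> arr C \<Longrightarrow> src C f = A \<Longrightarrow> f \<cdot> ident C A = f"
  "f \<in> arr C \<Longrightarrow> tgt C f = A \<Longrightarrow> ident C A \<cdot> f = f"
  using cmp_ident_right[of f A] cmp_ident_left[of f _ A] by (auto simp: mor_iff)

lemma assoc [simp]:
  "\<lbrakk>f \<in> arr C; g \<in> arr C; h \<in> arr C; src C g = tgt C f; src C h = tgt C g\<rbrakk>
    \<Longrightarrow> (h \<cdot> g) \<cdot> f = h \<cdot> (g \<cdot> f)"
  using cmp_assoc[of f "src C f" "tgt C f" g "tgt C g" h "tgt C h"] by (auto simp: mor_iff)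

text \<open>
  Composites are normalized by nesting to the right; this applies an equation for \<open>h \<cdot> g\<close> inside
  such a composite.
\<close>

lemma cmp_cong_left:
  assumes "h \<cdot> g = k" "f \<in> arr C" "g \<in> arr C" "h \<in> arr C" "src C g = tgt C f" "src C h = tgt C g"
  shows "h \<cdot> (g \<cdot> f) = k \<cdot> f"
proof -
  have "h \<cdot> (g \<cdot> f) = (h \<cdot> g) \<cdot> f" using assms(2-) by simp
  thus ?thesis by (simp only: assms(1))
qed

lemma iso_morI:
  "\<lbrakk>f \<in> arr C; g \<in> arr C; src C g = tgt C f; tgt C g = src C f;
    g \<cdot> f = ident C (src C f); f \<cdot> g = ident C (tgt C f)\<rbrakk> \<Longrightarrow> iso_mor C f"
  by (auto simp: iso_mor_def mor_iff intro!: bexI[of _ g])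

lemma iso_morE:
  assumes "iso_mor C f"
  obtains g where "f \<in> arr C" "g \<in> arr C" "src C g = tgt C f" "tgt C g = src C f"
    "g \<cdot> f = ident C (src C f)" "f \<cdot> g = ident C (tgt C f)" "iso_mor C g"
proof -
  from assms obtain g where g: "f \<in> arr C" "g \<in> arr C" "src C g = tgt C f" "tgt C g = src C f"
    "g \<cdot> f = ident C (src C f)" "f \<cdot> g = ident C (tgt C f)"
    by (auto simp: iso_mor_def mor_iff)
  moreover have "iso_mor C g" by (rule iso_morI[of _ f]) (use g in auto)
  ultimately show thesis using that by blast
qed

lemma iso_ident: "A \<in> obj C \<Longrightarrow> iso_mor C (ident C A)"
  by (rule iso_morI[of _ "ident C A"]) auto

lemma iso_cmp:
  assumes "iso_mor C f" "iso_mor C g" "src C g = tgt C f"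
  shows "iso_mor C (g \<cdot> f)"
proof -
  obtain f' where f: "f \<in> arr C" "f' \<in> arr C" "src C f' = tgt C f" "tgt C f' = src C f"
    "f' \<cdot> f = ident C (src C f)" "f \<cdot> f' = ident C (tgt C f)" using assms(1) by (rule iso_morE)
  obtain g' where g: "g \<in> arr C" "g' \<in> arr C" "src C g' = tgt C g" "tgt C g' = src C g"
    "g' \<cdot> g = ident C (src C g)" "g \<cdot> g' = ident C (tgt C g)" using assms(2) by (rule iso_morE)
  show ?thesis
    by (rule iso_morI[of _ "f' \<cdot> g'"])
      (use f g assms(3) cmp_cong_left[OF g(5)] cmp_cong_left[OF f(6)] in auto)
qed

lemma isomorphic_refl: "A \<in> obj C \<Longrightarrow> isomorphic_obj C A A"
  unfolding isomorphic_obj_def using iso_ident by (intro bexI[of _ "ident C A"]) (auto simp: mor_iff)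

lemma isomorphic_objE:
  assumes "isomorphic_obj C A B"
  obtains f where "iso_mor C f" "f \<in> arr C" "src C f = A" "tgt C f = B"
  using assms that by (auto simp: isomorphic_obj_def mor_iff)

lemma isomorphic_objI:
  "iso_mor C f \<Longrightarrow> f \<in> arr C \<Longrightarrow> src C f = A \<Longrightarrow> tgt C f = B \<Longrightarrow> isomorphic_obj C A B"
  by (auto simp: isomorphic_obj_def mor_iff)

lemma isomorphic_sym:
  assumes "isomorphic_obj C A B"
  shows "isomorphic_obj C B A"
proof -
  obtain f where f: "iso_mor C f" "src C f = A" "tgt C f = B"
    using assms by (rule isomorphic_objE)
  from f(1) show ?thesis by (rule iso_morE) (use f in \<open>auto intro: isomorphic_objI\<close>)
qed

lemma isomorphic_trans:
  assumes "isomorphic_obj C A B" "isomorphic_obj C B D"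
  shows "isomorphic_obj C A D"
proof -
  obtain f where f: "iso_mor C f" "f \<in> arr C" "src C f = A" "tgt C f = B"
    using assms(1) by (rule isomorphic_objE)
  obtain g where g: "iso_mor C g" "g \<in> arr C" "src C g = B" "tgt C g = D"
    using assms(2) by (rule isomorphic_objE)
  show ?thesis by (rule isomorphic_objI[of "g \<cdot> f"]) (use f g in \<open>auto intro: iso_cmp\<close>)
qed

end

definition neg :: "('o, 'm, 'z) preadditive_scheme \<Rightarrow> 'm \<Rightarrow> 'm" where
  "neg C f = inv\<^bsub>mor_group C (src C f) (tgt C f)\<^esub> f"

context additive_category
begin

lemma zero_arr [simp]:
  assumes "A \<in> obj C" "B \<in> obj C"
  shows "zero_mor C A B \<in> arr C" "src C (zero_mor C A B) = A" "tgt C (zero_mor C A B) = B"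
proof -
  interpret G: comm_group "mor_group C A B" by (rule mor_comm_group[OF assms])
  show "zero_mor C A B \<in> arr C" "src C (zero_mor C A B) = A" "tgt C (zero_mor C A B) = B"
    using G.one_closed by (auto simp: mor_group_def mor_iff)
qed

lemma plus_arr [simp]:
  assumes "f \<in> arr C" "g \<in> arr C" "src C f = src C g" "tgt C f = tgt C g"
  shows "f \<boxplus> g \<in> arr C" "src C (f \<boxplus> g) = src C g" "tgt C (f \<boxplus> g) = tgt C g"
proof -
  interpret G: comm_group "mor_group C (src C g) (tgt C g)" by (rule mor_comm_group) (use assms in auto)
  show "f \<boxplus> g \<in> arr C" "src C (f \<boxplus> g) = src C g" "tgt C (f \<boxplus> g) = tgt C g"
    using G.m_closed[of f g] assms by (auto simp: mor_group_def mor_iff)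
qed

lemma neg_arr [simp]:
  assumes "f \<in> arr C"
  shows "neg C f \<in> arr C" "src C (neg C f) = src C f" "tgt C (neg C f) = tgt C f"
proof -
  interpret G: comm_group "mor_group C (src C f) (tgt C f)" by (rule mor_comm_group) (use assms in auto)
  show "neg C f \<in> arr C" "src C (neg C f) = src C f" "tgt C (neg C f) = tgt C f"
    using G.inv_closed[of f] assms by (auto simp: mor_group_def mor_iff neg_def)
qed

lemma plus_comm:
  assumes "f \<in> arr C" "g \<in> arr C" "src C f = src C g" "tgt C f = tgt C g"
  shows "f \<boxplus> g = g \<boxplus> f"
proof -
  interpret G: comm_group "mor_group C (src C g) (tgt C g)" by (rule mor_comm_group) (use assms in auto)
  show ?thesis using G.m_comm[of f g] assms by (auto simp: mor_group_def mor_iff)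
qed

lemma plus_assoc:
  assumes "f \<in> arr C" "g \<in> arr C" "h \<in> arr C" "src C f = src C g" "tgt C f = tgt C g"
    "src C g = src C h" "tgt C g = tgt C h"
  shows "(f \<boxplus> g) \<boxplus> h = f \<boxplus> (g \<boxplus> h)"
proof -
  interpret G: comm_group "mor_group C (src C h) (tgt C h)" by (rule mor_comm_group) (use assms in auto)
  show ?thesis using G.m_assoc[of f g h] assms by (auto simp: mor_group_def mor_iff)
qed

lemma plus_zero [simp]:
  assumes "f \<in> arr C" "src C f = A" "tgt C f = B"
  shows "f \<boxplus> zero_mor C A B = f" "zero_mor C A B \<boxplus> f = f"
proof -
  interpret G: comm_group "mor_group C A B" by (rule mor_comm_group) (use assms in auto)
  show "f \<boxplus> zero_mor C A B = f" "zero_mor C A B \<boxplus> f = f"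
    using G.r_one[of f] G.l_one[of f] assms by (auto simp: mor_group_def mor_iff)
qed

lemma plus_neg [simp]:
  assumes "f \<in> arr C"
  shows "f \<boxplus> neg C f = zero_mor C (src C f) (tgt C f)"
    "neg C f \<boxplus> f = zero_mor C (src C f) (tgt C f)"
proof -
  interpret G: comm_group "mor_group C (src C f) (tgt C f)" by (rule mor_comm_group) (use assms in auto)
  show "f \<boxplus> neg C f = zero_mor C (src C f) (tgt C f)"
    "neg C f \<boxplus> f = zero_mor C (src C f) (tgt C f)"
    using G.r_inv[of f] G.l_inv[of f] assms by (auto simp: mor_group_def mor_iff neg_def)
qed

lemma plus_left_cancel:
  assumes "f \<in> arr C" "g \<in> arr C" "h \<in> arr C" "src C f = src C g" "tgt C f = tgt C g"
    "src C g = src C h" "tgt C g = tgt C h" "f \<boxplus> g = f \<boxplus> h"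
  shows "g = h"
proof -
  interpret G: comm_group "mor_group C (src C h) (tgt C h)" by (rule mor_comm_group) (use assms in auto)
  show ?thesis using G.right_cancel[of f g h] plus_comm[of f g] plus_comm[of f h] assms by (simp add: mor_group_def mor_iff)
qed

lemma cmp_plus [simp]:
  "\<lbrakk>f \<in> arr C; f' \<in> arr C; g \<in> arr C; src C f = src C f'; tgt C f = tgt C f'; src C g = tgt C f'\<rbrakk>
     \<Longrightarrow> g \<cdot> (f \<boxplus> f') = (g \<cdot> f) \<boxplus> (g \<cdot> f')"
  "\<lbrakk>f \<in> arr C; g \<in> arr C; g' \<in> arr C; src C g = src C g'; tgt C g = tgt C g'; src C g' = tgt C f\<rbrakk>
     \<Longrightarrow> (g \<boxplus> g') \<cdot> f = (g \<cdot> f) \<boxplus> (g' \<cdot> f)"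
  using cmp_plus_right[of f "src C f" "tgt C f" f' g "tgt C g"]
    cmp_plus_left[of f "src C f" "tgt C f" g "tgt C g" g'] by (auto simp: mor_iff)

lemma cmp_zero [simp]:
  assumes "g \<in> arr C" "X \<in> obj C"
  shows "src C g = A \<Longrightarrow> g \<cdot> zero_mor C X A = zero_mor C X (tgt C g)"
    "tgt C g = A \<Longrightarrow> zero_mor C A X \<cdot> g = zero_mor C (src C g) X"
proof -
  show "g \<cdot> zero_mor C X A = zero_mor C X (tgt C g)" if A: "src C g = A"
  proof (rule plus_left_cancel[of "g \<cdot> zero_mor C X A"])
    have "A \<in> obj C" using A assms by auto
    have "g \<cdot> zero_mor C X A \<boxplus> g \<cdot> zero_mor C X A = g \<cdot> (zero_mor C X A \<boxplus> zero_mor C X A)"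
      by (rule cmp_plus[symmetric]) (use A assms in auto)
    also have "\<dots> = g \<cdot> zero_mor C X A" using A assms \<open>A \<in> obj C\<close> by (auto simp del: cmp_plus)
    also have "\<dots> = g \<cdot> zero_mor C X A \<boxplus> zero_mor C X (tgt C g)" using A assms by auto
    finally show "g \<cdot> zero_mor C X A \<boxplus> g \<cdot> zero_mor C X A = g \<cdot> zero_mor C X A \<boxplus> zero_mor C X (tgt C g)" .
  qed (use A assms in auto)
  show "zero_mor C A X \<cdot> g = zero_mor C (src C g) X" if A: "tgt C g = A"
  proof (rule plus_left_cancel[of "zero_mor C A X \<cdot> g"])
    have "A \<in> obj C" using A assms by auto
    have "zero_mor C A X \<cdot> g \<boxplus> zero_mor C A X \<cdot> g = (zero_mor C A X \<boxplus> zero_mor C A X) \<cdot> g"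
      by (rule cmp_plus[symmetric]) (use A assms in auto)
    also have "\<dots> = zero_mor C A X \<cdot> g" using A assms \<open>A \<in> obj C\<close> by (auto simp del: cmp_plus)
    also have "\<dots> = zero_mor C A X \<cdot> g \<boxplus> zero_mor C (src C g) X" using A assms by auto
    finally show "zero_mor C A X \<cdot> g \<boxplus> zero_mor C A X \<cdot> g = zero_mor C A X \<cdot> g \<boxplus> zero_mor C (src C g) X" .
  qed (use A assms in auto)
qed

lemma cmp_neg [simp]:
  assumes "f \<in> arr C" "g \<in> arr C" "src C g = tgt C f"
  shows "g \<cdot> neg C f = neg C (g \<cdot> f)" "neg C g \<cdot> f = neg C (g \<cdot> f)"
proof -
  show "g \<cdot> neg C f = neg C (g \<cdot> f)"
  proof (rule plus_left_cancel[of "g \<cdot> f"])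
    have "g \<cdot> f \<boxplus> g \<cdot> neg C f = g \<cdot> (f \<boxplus> neg C f)"
      by (rule cmp_plus[symmetric]) (use assms in auto)
    thus "g \<cdot> f \<boxplus> g \<cdot> neg C f = g \<cdot> f \<boxplus> neg C (g \<cdot> f)" using assms by (auto simp del: cmp_plus)
  qed (use assms in auto)
  show "neg C g \<cdot> f = neg C (g \<cdot> f)"
  proof (rule plus_left_cancel[of "g \<cdot> f"])
    have "g \<cdot> f \<boxplus> neg C g \<cdot> f = (g \<boxplus> neg C g) \<cdot> f"
      by (rule cmp_plus[symmetric]) (use assms in auto)
    thus "g \<cdot> f \<boxplus> neg C g \<cdot> f = g \<cdot> f \<boxplus> neg C (g \<cdot> f)" using assms by (auto simp del: cmp_plus)
  qed (use assms in auto)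
qed

lemma minus_plus_cancel:
  assumes "f \<in> arr C" "g \<in> arr C" "src C f = src C g" "tgt C f = tgt C g"
  shows "(f \<boxplus> neg C g) \<boxplus> g = f" "g \<boxplus> (f \<boxplus> neg C g) = f"
proof -
  show 1: "(f \<boxplus> neg C g) \<boxplus> g = f" using assms by (simp add: plus_assoc)
  show "g \<boxplus> (f \<boxplus> neg C g) = f" using assms 1 by (subst plus_comm) auto
qed

lemma minus_eq_iff:
  assumes "f \<in> arr C" "g \<in> arr C" "h \<in> arr C" "src C f = src C g" "tgt C f = tgt C g"
    "src C g = src C h" "tgt C g = tgt C h"
  shows "f \<boxplus> neg C g = h \<longleftrightarrow> f = h \<boxplus> g"
proof
  assume "f \<boxplus> neg C g = h"
  thus "f = h \<boxplus> g" using minus_plus_cancel(1)[OF assms(1,2,4,5)] by simp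
next
  assume "f = h \<boxplus> g"
  thus "f \<boxplus> neg C g = h" using assms by (simp add: plus_assoc)
qed

lemma zero_object_obj: "zero_object C Z \<Longrightarrow> Z \<in> obj C"
  by (simp add: zero_object_def)

lemma from_zero_object:
  assumes "zero_object C Z" "f \<in> arr C" "g \<in> arr C" "tgt C f = tgt C g" "src C f = Z" "src C g = Z"
  shows "f = g"
  using assms tgt_in_obj[of f] unfolding zero_object_def mor_iff by metis

lemma biproductD:
  assumes "biproduct C A B P i j p q"
  shows "A \<in> obj C" "B \<in> obj C" "P \<in> obj C"
    "i \<in> arr C" "j \<in> arr C" "p \<in> arr C" "q \<in> arr C"
    "src C i = A" "tgt C i = P" "src C j = B" "tgt C j = P"
    "src C p = P" "tgt C p = A" "src C q = P" "tgt C q = B"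
    "p \<cdot> i = ident C A" "q \<cdot> j = ident C B"
    "q \<cdot> i = zero_mor C A B" "p \<cdot> j = zero_mor C B A"
    "(i \<cdot> p) \<boxplus> (j \<cdot> q) = ident C P"
  using assms by (auto simp: biproduct_def mor_iff)

lemma biproductI:
  assumes "A \<in> obj C" "B \<in> obj C" "P \<in> obj C"
    "i \<in> arr C" "j \<in> arr C" "p \<in> arr C" "q \<in> arr C"
    "src C i = A" "tgt C i = P" "src C j = B" "tgt C j = P"
    "src C p = P" "tgt C p = A" "src C q = P" "tgt C q = B"
    "p \<cdot> i = ident C A" "q \<cdot> j = ident C B"
    "q \<cdot> i = zero_mor C A B" "p \<cdot> j = zero_mor C B A"
    "(i \<cdot> p) \<boxplus> (j \<cdot> q) = ident C P"
  shows "biproduct C A B P i j p q"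
  using assms by (auto simp: biproduct_def mor_iff)

lemma biproduct_swap:
  assumes "biproduct C A B P i j p q"
  shows "biproduct C B A P j i q p"
  using biproductD[OF assms] by (intro biproductI) (auto simp: plus_comm)

lemma biproduct_zero_right:
  assumes "zero_object C Z" "A \<in> obj C"
  shows "biproduct C A Z A (ident C A) (zero_mor C Z A) (ident C A) (zero_mor C A Z)"
  using assms(2) zero_object_obj[OF assms(1)]
  by (intro biproductI) (auto intro!: from_zero_object[OF assms(1)])

lemma biproduct_zero_left:
  assumes "zero_object C Z" "A \<in> obj C"
  shows "biproduct C Z A A (zero_mor C Z A) (ident C A) (zero_mor C A Z) (ident C A)"
  using biproduct_zero_right[OF assms] by (rule biproduct_swap)

lemma biproduct_iso:
  assumes P: "biproduct C A B P i j p q"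
    and b: "b \<in> arr C" "b' \<in> arr C" "src C b = P" "tgt C b = Q" "src C b' = Q" "tgt C b' = P"
      "b' \<cdot> b = ident C P" "b \<cdot> b' = ident C Q"
  shows "biproduct C A B Q (b \<cdot> i) (b \<cdot> j) (p \<cdot> b') (q \<cdot> b')"
proof -
  note D = biproductD[OF P]
  have "b \<cdot> ((i \<cdot> p \<boxplus> j \<cdot> q) \<cdot> b') = ident C Q" unfolding D(20) using b by simp
  hence "b \<cdot> (i \<cdot> (p \<cdot> b')) \<boxplus> b \<cdot> (j \<cdot> (q \<cdot> b')) = ident C Q" using D(1-15) b by simp
  then show ?thesis
    using D b tgt_in_obj[OF b(1)]
    by (intro biproductI) (auto simp: cmp_cong_left[OF b(7)])
qed

end


section \<open>Extensions and their realizations\<close>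

context extriangulated_category
begin

lemma push_closed [simp]:
  assumes "D \<in> obj C" "a \<in> arr C" "tgt C a = A'" "\<delta> \<in> carrier (Ext C D (src C a))"
  shows "push C D a \<delta> \<in> carrier (Ext C D A')"
  using Emap_hom[of "ident C D" D D a "src C a" A'] assms
  by (auto simp: push_def mor_iff hom_def)

lemma pull_closed [simp]:
  assumes "A \<in> obj C" "c \<in> arr C" "src C c = D'" "\<delta> \<in> carrier (Ext C (tgt C c) A)"
  shows "pull C A c \<delta> \<in> carrier (Ext C D' A)"
  using Emap_hom[of c D' "tgt C c" "ident C A" A A] assms
  by (auto simp: pull_def mor_iff hom_def)

lemma push_ident [simp]:
  "\<lbrakk>D \<in> obj C; A \<in> obj C; \<delta> \<in> carrier (Ext C D A)\<rbrakk> \<Longrightarrow> push C D (ident C A) \<delta> = \<delta>"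
  and pull_ident [simp]:
  "\<lbrakk>D \<in> obj C; A \<in> obj C; \<delta> \<in> carrier (Ext C D A)\<rbrakk> \<Longrightarrow> pull C A (ident C D) \<delta> = \<delta>"
  by (simp_all add: push_def pull_def Emap_ident)

lemma push_cmp:
  assumes "D \<in> obj C" "a \<in> arr C" "a' \<in> arr C" "src C a' = tgt C a" "\<delta> \<in> carrier (Ext C D (src C a))"
  shows "push C D (a' \<cdot> a) \<delta> = push C D a' (push C D a \<delta>)"
  using Emap_cmp[of "ident C D" D D "ident C D" D a "src C a" "tgt C a" a' "tgt C a'" \<delta>] assms
  by (simp add: push_def mor_iff)

lemma pull_cmp:
  assumes "A \<in> obj C" "c \<in> arr C" "c' \<in> arr C" "src C c = tgt C c'" "\<delta> \<in> carrier (Ext C (tgt C c) A)"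
  shows "pull C A (c \<cdot> c') \<delta> = pull C A c' (pull C A c \<delta>)"
  using Emap_cmp[of c "src C c" "tgt C c" c' "src C c'" "ident C A" A A "ident C A" A \<delta>] assms
  by (simp add: pull_def mor_iff)

text \<open>
  \<open>E(c, a)\<close> is split into its two variables, in this fixed order, by functoriality.
\<close>

lemma Emap_eq_push_pull:
  assumes "a \<in> arr C" "c \<in> arr C" "src C a = A" "src C c = D'" "\<delta> \<in> carrier (Ext C (tgt C c) A)"
  shows "Emap C c a \<delta> = push C D' a (pull C A c \<delta>)"
  using Emap_cmp[of c D' "tgt C c" "ident C D'" D' "ident C A" A A a "tgt C a" \<delta>] assms
  by (auto simp: push_def pull_def mor_iff)

lemma push_pull_commute:
  assumes "a \<in> arr C" "c \<in> arr C" "src C a = A" "tgt C a = A'" "src C c = D'" "tgt C c = D"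
    "\<delta> \<in> carrier (Ext C D A)"
  shows "push C D' a (pull C A c \<delta>) = pull C A' c (push C D a \<delta>)"
  using Emap_cmp[of c D' D "ident C D'" D' "ident C A" A A a A' \<delta>]
    Emap_cmp[of "ident C D" D D c D' a A A' "ident C A'" A' \<delta>] assms
  by (auto simp: push_def pull_def mor_iff)

lemma Ext_group: "\<lbrakk>D \<in> obj C; A \<in> obj C\<rbrakk> \<Longrightarrow> group (Ext C D A)"
  using Ext_comm_group by (simp add: comm_group_def)

lemma Ext_one_closed [simp]: "\<lbrakk>D \<in> obj C; A \<in> obj C\<rbrakk> \<Longrightarrow> \<one>\<^bsub>Ext C D A\<^esub> \<in> carrier (Ext C D A)"
  by (simp add: Ext_group group.is_monoid)

lemma push_one [simp]:
  assumes "D \<in> obj C" "a \<in> arr C" "src C a = A"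
  shows "push C D a \<one>\<^bsub>Ext C D A\<^esub> = \<one>\<^bsub>Ext C D (tgt C a)\<^esub>"
  using Emap_hom[of "ident C D" D D a A "tgt C a"] assms
    hom_one[of _ "Ext C D A" "Ext C D (tgt C a)"] Ext_group
  by (auto simp: push_def mor_iff)

lemma pull_one [simp]:
  assumes "A \<in> obj C" "c \<in> arr C" "tgt C c = D"
  shows "pull C A c \<one>\<^bsub>Ext C D A\<^esub> = \<one>\<^bsub>Ext C (src C c) A\<^esub>"
  using Emap_hom[of c "src C c" D "ident C A" A A] assms
    hom_one[of _ "Ext C D A" "Ext C (src C c) A"] Ext_group
  by (auto simp: pull_def mor_iff)

lemma pull_mult:
  assumes "A \<in> obj C" "c \<in> arr C" "\<delta> \<in> carrier (Ext C (tgt C c) A)" "\<epsilon> \<in> carrier (Ext C (tgt C c) A)"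
  shows "pull C A c (\<delta> \<otimes>\<^bsub>Ext C (tgt C c) A\<^esub> \<epsilon>) = pull C A c \<delta> \<otimes>\<^bsub>Ext C (src C c) A\<^esub> pull C A c \<epsilon>"
  using Emap_hom[of c "src C c" "tgt C c" "ident C A" A A] assms
  by (auto simp: pull_def mor_iff hom_def)

lemma push_plus':
  assumes "D \<in> obj C" "a \<in> arr C" "a' \<in> arr C" "src C a = src C a'" "tgt C a = tgt C a'"
    "\<delta> \<in> carrier (Ext C D (src C a'))"
  shows "push C D (a \<boxplus> a') \<delta> = push C D a \<delta> \<otimes>\<^bsub>Ext C D (tgt C a')\<^esub> push C D a' \<delta>"
  using push_plus[of D a "src C a'" "tgt C a'" a' \<delta>] assms by (simp add: mor_iff)

lemma pull_plus':
  assumes "A \<in> obj C" "c \<in> arr C" "c' \<in> arr C" "src C c = src C c'" "tgt C c = tgt C c'"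
    "\<delta> \<in> carrier (Ext C (tgt C c') A)"
  shows "pull C A (c \<boxplus> c') \<delta> = pull C A c \<delta> \<otimes>\<^bsub>Ext C (src C c') A\<^esub> pull C A c' \<delta>"
  using pull_plus[of A c "src C c'" "tgt C c'" c' \<delta>] assms by (simp add: mor_iff)

lemma push_zero [simp]:
  assumes "D \<in> obj C" "A \<in> obj C" "A' \<in> obj C" "\<delta> \<in> carrier (Ext C D A)"
  shows "push C D (zero_mor C A A') \<delta> = \<one>\<^bsub>Ext C D A'\<^esub>"
proof -
  interpret G: group "Ext C D A'" by (rule Ext_group) (use assms in auto)
  have "push C D (zero_mor C A A') \<delta> \<otimes>\<^bsub>Ext C D A'\<^esub> push C D (zero_mor C A A') \<delta>
      = push C D (zero_mor C A A') \<delta>"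
    using push_plus'[of D "zero_mor C A A'" "zero_mor C A A'" \<delta>] assms by simp
  thus ?thesis using assms by simp
qed

lemma pull_zero [simp]:
  assumes "D \<in> obj C" "D' \<in> obj C" "A \<in> obj C" "\<delta> \<in> carrier (Ext C D A)"
  shows "pull C A (zero_mor C D' D) \<delta> = \<one>\<^bsub>Ext C D' A\<^esub>"
proof -
  interpret G: group "Ext C D' A" by (rule Ext_group) (use assms in auto)
  have "pull C A (zero_mor C D' D) \<delta> \<otimes>\<^bsub>Ext C D' A\<^esub> pull C A (zero_mor C D' D) \<delta>
      = pull C A (zero_mor C D' D) \<delta>"
    using pull_plus'[of A "zero_mor C D' D" "zero_mor C D' D" \<delta>] assms by simp
  thus ?thesis using assms by simp
qed

text \<open>
  The passage from an equation between pullbacks to a vanishing one, where exactness applies.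
\<close>

lemma pull_diff_eq_one:
  assumes "A \<in> obj C" "c \<in> arr C" "c' \<in> arr C" "src C c = src C c'" "tgt C c = tgt C c'"
    "\<delta> \<in> carrier (Ext C (tgt C c') A)" "pull C A c \<delta> = pull C A c' \<delta>"
  shows "pull C A (c \<boxplus> neg C c') \<delta> = \<one>\<^bsub>Ext C (src C c') A\<^esub>"
proof -
  interpret G: group "Ext C (src C c') A" by (rule Ext_group) (use assms in auto)
  have "pull C A (c \<boxplus> neg C c') \<delta> \<otimes>\<^bsub>Ext C (src C c') A\<^esub> pull C A c' \<delta> = pull C A c \<delta>"
    using pull_plus'[of A "c \<boxplus> neg C c'" c' \<delta>] minus_plus_cancel(1)[of c c'] assms(1-6) by simp
  thus ?thesis using assms by simp
qed

lemma rz_eq: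
  assumes "D \<in> obj C" "A \<in> obj C" "\<delta> \<in> carrier (Ext C D A)"
  obtains s where "s \<in> seqs C D A" "rz C D A \<delta> = seq_rel C D A `` {s}"
  using rz_class[OF assms] by (auto simp: quotient_def)

lemma seq_relD:
  assumes "((x, y), (x', y')) \<in> seq_rel C D A"
  obtains b where "x \<in> arr C" "y \<in> arr C" "x' \<in> arr C" "y' \<in> arr C"
    "src C x = A" "src C x' = A" "tgt C y = D" "tgt C y' = D" "tgt C x = src C y" "tgt C x' = src C y'"
    "iso_mor C b" "b \<in> arr C" "src C b = src C y" "tgt C b = src C y'" "b \<cdot> x = x'" "y' \<cdot> b = y"
proof -
  have s: "(x, y) \<in> seqs C D A" "(x', y') \<in> seqs C D A"
    and "\<exists>b \<in> mor C (tgt C x) (tgt C x'). iso_mor C b \<and> b \<cdot> x = x' \<and> y' \<cdot> b = y"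
    using assms by (simp_all add: seq_rel_def)
  then obtain b where "b \<in> arr C" "src C b = tgt C x" "tgt C b = tgt C x'" "iso_mor C b"
    "b \<cdot> x = x'" "y' \<cdot> b = y" unfolding mor_iff Bex_def by blast
  thus thesis using s by (intro that[of b]) (simp_all add: seqs_def)
qed

lemma seq_relI:
  assumes "iso_mor C b" "b \<in> arr C" "x \<in> arr C" "y' \<in> arr C" "src C b = tgt C x" "src C y' = tgt C b"
    "src C x = A" "tgt C y' = D" "b \<cdot> x = x'" "y' \<cdot> b = y"
  shows "((x, y), (x', y')) \<in> seq_rel C D A"
  using assms by (auto simp: seq_rel_def seqs_def mor_iff)

lemma seq_rel_equiv: "equiv (seqs C D A) (seq_rel C D A)"
proof (rule equivI)
  show "seq_rel C D A \<subseteq> seqs C D A \<times> seqs C D A" by (auto simp: seq_rel_def)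
  show "refl_on (seqs C D A) (seq_rel C D A)"
  proof (rule refl_onI)
    fix s assume s: "s \<in> seqs C D A"
    obtain x y where [simp]: "s = (x, y)" by fastforce
    show "(s, s) \<in> seq_rel C D A"
      using s by (auto simp: seqs_def intro!: seq_relI[of "ident C (src C y)"] iso_ident)
  qed
  show "sym (seq_rel C D A)"
  proof (rule symI)
    fix s t assume st: "(s, t) \<in> seq_rel C D A"
    obtain x y x' y' where [simp]: "s = (x, y)" "t = (x', y')" by fastforce
    from st have "((x, y), (x', y')) \<in> seq_rel C D A" by simp
    then obtain b where b: "x \<in> arr C" "y \<in> arr C" "x' \<in> arr C" "y' \<in> arr C"
      "src C x = A" "src C x' = A" "tgt C y = D" "tgt C y' = D" "tgt C x = src C y" "tgt C x' = src C y'"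
      "iso_mor C b" "b \<in> arr C" "src C b = src C y" "tgt C b = src C y'" "b \<cdot> x = x'" "y' \<cdot> b = y"
      by (rule seq_relD)
    obtain c where c: "c \<in> arr C" "src C c = tgt C b" "tgt C c = src C b"
      "c \<cdot> b = ident C (src C b)" "b \<cdot> c = ident C (tgt C b)" "iso_mor C c"
      using b(11) by (rule iso_morE)
    have "c \<cdot> x' = x" unfolding b(15)[symmetric] using b(1-14) c cmp_cong_left[OF c(4), of x] by simp
    moreover have "y \<cdot> c = y'" unfolding b(16)[symmetric] using b(1-14) c by simp
    ultimately show "(t, s) \<in> seq_rel C D A"
      using b(1-10,13,14) c(1-3,6) by (simp add: seq_relI[of c])
  qed
  show "trans (seq_rel C D A)"
  proof (rule transI)
    fix s t u assume st: "(s, t) \<in> seq_rel C D A" "(t, u) \<in> seq_rel C D A"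
    obtain x y x' y' x'' y'' where [simp]: "s = (x, y)" "t = (x', y')" "u = (x'', y'')"
      by (metis surj_pair)
    from st have st': "((x, y), (x', y')) \<in> seq_rel C D A" "((x', y'), (x'', y'')) \<in> seq_rel C D A" by auto
    obtain b where b: "x \<in> arr C" "y \<in> arr C" "x' \<in> arr C" "y' \<in> arr C"
      "src C x = A" "src C x' = A" "tgt C y = D" "tgt C y' = D" "tgt C x = src C y" "tgt C x' = src C y'"
      "iso_mor C b" "b \<in> arr C" "src C b = src C y" "tgt C b = src C y'" "b \<cdot> x = x'" "y' \<cdot> b = y"
      using st'(1) by (rule seq_relD)
    obtain c where c: "x' \<in> arr C" "y' \<in> arr C" "x'' \<in> arr C" "y'' \<in> arr C"
      "src C x' = A" "src C x'' = A" "tgt C y' = D" "tgt C y'' = D" "tgt C x' = src C y'" "tgt C x'' = src C y''"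
      "iso_mor C c" "c \<in> arr C" "src C c = src C y'" "tgt C c = src C y''" "c \<cdot> x' = x''" "y'' \<cdot> c = y'"
      using st'(2) by (rule seq_relD)
    have "(c \<cdot> b) \<cdot> x = x''" using b(1-15) c(1-15) by simp
    moreover have "y'' \<cdot> (c \<cdot> b) = y" using b(1-14,16) c(1-14) cmp_cong_left[OF c(16), of b] by simp
    moreover have "iso_mor C (c \<cdot> b)" using b(1-14) c(1-14) by (intro iso_cmp) auto
    ultimately show "(s, u) \<in> seq_rel C D A"
      using b(1-14) c(1-14) by (simp add: seq_relI[of "c \<cdot> b"])
  qed
qed

lemma realizesD:
  assumes "realizes C x y D A \<delta>"
  shows "D \<in> obj C" "A \<in> obj C" "\<delta> \<in> carrier (Ext C D A)" "x \<in> arr C" "y \<in> arr C"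
    "src C x = A" "tgt C x = src C y" "tgt C y = D"
proof -
  show 1: "D \<in> obj C" "A \<in> obj C" "\<delta> \<in> carrier (Ext C D A)" using assms by (auto simp: realizes_def)
  obtain s where "rz C D A \<delta> = seq_rel C D A `` {s}" using 1 by (rule rz_eq)
  hence "(x, y) \<in> seqs C D A" using assms by (auto simp: realizes_def seq_rel_def)
  thus "x \<in> arr C" "y \<in> arr C" "src C x = A" "tgt C x = src C y" "tgt C y = D"
    by (auto simp: seqs_def)
qed

lemma ex_realization:
  assumes "D \<in> obj C" "A \<in> obj C" "\<delta> \<in> carrier (Ext C D A)"
  obtains x y where "realizes C x y D A \<delta>"
proof -
  obtain s where s: "s \<in> seqs C D A" "rz C D A \<delta> = seq_rel C D A `` {s}" using assms by (rule rz_eq)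
  have "s \<in> rz C D A \<delta>" unfolding s(2) using equiv_class_self[OF seq_rel_equiv s(1)] .
  thus thesis using that[of "fst s" "snd s"] assms by (simp add: realizes_def)
qed

lemma realizes_unique:
  assumes "realizes C x y D A \<delta>" "realizes C x' y' D A \<delta>"
  shows "((x, y), (x', y')) \<in> seq_rel C D A"
proof -
  have 1: "D \<in> obj C" "A \<in> obj C" "\<delta> \<in> carrier (Ext C D A)" using assms by (auto simp: realizes_def)
  obtain s where s: "rz C D A \<delta> = seq_rel C D A `` {s}" using 1 by (rule rz_eq)
  show ?thesis using assms seq_rel_equiv[of D A] unfolding realizes_def s equiv_def sym_def trans_def by blast
qed

text \<open>
  The converse of \<open>realizes_unique\<close>: the middle term of a realization can be moved along an
  isomorphism.
\<close>

lemma realizes_iso: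
  assumes "realizes C x y D A \<delta>" "iso_mor C b" "b \<in> arr C" "src C b = src C y" "tgt C b = src C y'"
    "y' \<in> arr C" "y' \<cdot> b = y"
  shows "realizes C (b \<cdot> x) y' D A \<delta>"
proof -
  note D = realizesD[OF assms(1)]
  obtain s where s: "rz C D A \<delta> = seq_rel C D A `` {s}" using D(1-3) by (rule rz_eq)
  have "tgt C y' = D" using assms D cmp_arr(3)[of b y'] by simp
  hence "((x, y), (b \<cdot> x, y')) \<in> seq_rel C D A"
    using assms D by (intro seq_relI[of b]) auto
  moreover have "(s, (x, y)) \<in> seq_rel C D A" using assms(1) unfolding realizes_def s by auto
  ultimately have "(b \<cdot> x, y') \<in> seq_rel C D A `` {s}"
    using seq_rel_equiv[of D A] unfolding equiv_def trans_def by blast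
  thus ?thesis using D(1-3) by (simp add: realizes_def s)
qed

text \<open>
  These two conflations, from \<open>A \<rightarrow> A \<rightarrow> 0\<close> and \<open>0 \<rightarrow> A \<rightarrow> A\<close>, are the test objects from which the
  exact sequences below are derived: a morphism of extensions to or from them is the same as an
  extension or a lift of a single morphism.
\<close>

lemma realizes_ident:
  assumes "zero_object C Z" "A \<in> obj C"
  shows "realizes C (ident C A) (zero_mor C A Z) Z A \<one>\<^bsub>Ext C Z A\<^esub>"
    "realizes C (zero_mor C Z A) (ident C A) A Z \<one>\<^bsub>Ext C A Z\<^esub>"
  using rz_zero[OF biproduct_zero_right[OF assms]] rz_zero[OF biproduct_zero_left[OF assms]] .

lemma obtain_zero_object:
  obtains Z where "zero_object C Z" "Z \<in> obj C"
  using ex_zero_object zero_object_obj by blast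

end


section \<open>Duality\<close>

text \<open>
  The additional fields of \<open>C\<close> are dropped. Swapping each realizing pair \<open>(x, y)\<close> exchanges
  inflations and deflations.
\<close>

definition opposite :: "('o, 'm, 'e, 'z) extri_scheme \<Rightarrow> ('o, 'm, 'e) extri" where
  "opposite C = \<lparr>obj = obj C, arr = arr C, src = tgt C, tgt = src C, ident = ident C,
     cmp = (\<lambda>g f. cmp C f g), plus_mor = plus_mor C, zero_mor = (\<lambda>A B. zero_mor C B A),
     Ext = (\<lambda>D A. Ext C A D), Emap = (\<lambda>c a. Emap C a c), rz = (\<lambda>D A \<delta>. prod.swap ` rz C A D \<delta>)\<rparr>"

lemma opposite_simps [simp]:
  "obj (opposite C) = obj C" "arr (opposite C) = arr C" "src (opposite C) = tgt C"
  "tgt (opposite C) = src C" "ident (opposite C) = ident C" "cmp (opposite C) g f = cmp C f g"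
  "plus_mor (opposite C) = plus_mor C" "zero_mor (opposite C) A B = zero_mor C B A"
  "Ext (opposite C) D A = Ext C A D" "Emap (opposite C) c a = Emap C a c"
  "rz (opposite C) D A \<delta> = prod.swap ` rz C A D \<delta>"
  by (simp_all add: opposite_def)

lemma mor_opposite [simp]: "mor (opposite C) A B = mor C B A"
  by (auto simp: mor_def)

lemma push_opposite [simp]: "push (opposite C) D a \<delta> = pull C D a \<delta>"
  and pull_opposite [simp]: "pull (opposite C) A c \<delta> = push C A c \<delta>"
  by (simp_all add: push_def pull_def)

lemma realizes_opposite [simp]: "realizes (opposite C) x y D A \<delta> \<longleftrightarrow> realizes C y x A D \<delta>"
  by (force simp: realizes_def image_iff)

lemma conflation_opposite [simp]: "conflation (opposite C) x y \<longleftrightarrow> conflation C y x"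
  by (simp add: conflation_def)

lemma inflation_opposite [simp]: "inflation (opposite C) f \<longleftrightarrow> deflation C f"
  and deflation_opposite [simp]: "deflation (opposite C) f \<longleftrightarrow> inflation C f"
  by (simp_all add: inflation_def deflation_def)

lemma is_Cone_opposite [simp]: "is_Cone (opposite C) f D \<longleftrightarrow> is_CoCone C f D"
  and is_CoCone_opposite [simp]: "is_CoCone (opposite C) f D \<longleftrightarrow> is_Cone C f D"
  by (simp_all add: is_Cone_def is_CoCone_def)

lemma iso_mor_opposite [simp]: "iso_mor (opposite C) f \<longleftrightarrow> iso_mor C f"
  by (auto simp: iso_mor_def)

lemma zero_object_opposite [simp]: "zero_object (opposite C) Z \<longleftrightarrow> zero_object C Z"
  by (auto simp: zero_object_def)

lemma biproduct_opposite [simp]: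
  "biproduct (opposite C) A B P i j p q \<longleftrightarrow> biproduct C A B P p q i j"
  by (auto simp: biproduct_def)

lemma Infl_opposite [simp]: "Infl (opposite C) U = Defl C U"
  and Defl_opposite [simp]: "Defl (opposite C) U = Infl C U"
  by (simp_all add: Infl_def Defl_def)

lemma lifts_opposite [simp]: "lifts (opposite C) l r \<longleftrightarrow> lifts C r l"
proof -
  have "lifts (opposite C) l r" if "lifts C r l"
    using that unfolding lifts_def by (simp, metis)
  moreover have "lifts C r l" if "lifts (opposite C) l r"
    using that unfolding lifts_def by (simp, metis)
  ultimately show ?thesis by blast
qed

lemma right_lift_opposite [simp]: "right_lift (opposite C) M = left_lift C M"
  and left_lift_opposite [simp]: "left_lift (opposite C) M = right_lift C M"
  by (simp_all add: right_lift_def left_lift_def)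

context extriangulated_category
begin

text \<open>
  Reversing the arrows inverts the isomorphism between the middle terms, so the relation for
  \<open>opposite C\<close> is the converse of that for \<open>C\<close>; both are symmetric.
\<close>

lemma seq_rel_opposite:
  "((x, y), (x', y')) \<in> seq_rel (opposite C) D A \<longleftrightarrow> ((y, x), (y', x')) \<in> seq_rel C A D"
proof -
  have seqs: "(x, y) \<in> seqs (opposite C) D A \<longleftrightarrow> (y, x) \<in> seqs C A D" for x y
    by (auto simp: seqs_def)
  have "((y', x'), (y, x)) \<in> seq_rel C A D" if "((x, y), (x', y')) \<in> seq_rel (opposite C) D A"
    using that seqs by (auto simp: seq_rel_def seqs_def)
  moreover have "((x, y), (x', y')) \<in> seq_rel (opposite C) D A" if "((y', x'), (y, x)) \<in> seq_rel C A D"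
    using that seqs by (auto simp: seq_rel_def seqs_def)
  ultimately show ?thesis using seq_rel_equiv[of A D] unfolding equiv_def sym_def by blast
qed

text \<open>
  Each axiom of the opposite category is the axiom of the original category with the opposite
  variance: (ET3) and (ET4) trade places with their duals.
\<close>

lemma opposite_extriangulated: "extriangulated_category (opposite C)"
proof (intro extriangulated_category.intro additive_category.intro category.intro
    additive_category_axioms.intro extriangulated_category_axioms.intro)
  fix A B assume "A \<in> obj (opposite C)" "B \<in> obj (opposite C)"
  thus "comm_group (mor_group (opposite C) A B)"
    using mor_comm_group[of B A] by (simp add: mor_group_def)
next
  fix A B assume "A \<in> obj (opposite C)" "B \<in> obj (opposite C)"
  thus "\<exists>P i j p q. biproduct (opposite C) A B P i j p q"
    using ex_biproduct[of A B] by simp blast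
next
  fix D A \<delta> assume a: "D \<in> obj (opposite C)" "A \<in> obj (opposite C)" "\<delta> \<in> carrier (Ext (opposite C) D A)"
  then obtain s where s: "s \<in> seqs C A D" "rz C A D \<delta> = seq_rel C A D `` {s}" using rz_eq[of A D \<delta>] by auto
  have "rz (opposite C) D A \<delta> = seq_rel (opposite C) D A `` {prod.swap s}"
    by (cases s) (force simp: s(2) image_iff seq_rel_opposite)
  moreover have "prod.swap s \<in> seqs (opposite C) D A" using s(1) by (auto simp: seqs_def)
  ultimately show "rz (opposite C) D A \<delta> \<in> seqs (opposite C) D A // seq_rel (opposite C) D A"
    by (simp add: quotientI)
next
  fix x y D A \<delta> x' y' D' A' \<delta>' a c
  assume 1: "realizes (opposite C) x y D A \<delta>" "realizes (opposite C) x' y' D' A' \<delta>'"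
    "a \<in> mor (opposite C) A A'" "c \<in> mor (opposite C) D D'"
    "push (opposite C) D a \<delta> = pull (opposite C) A' c \<delta>'"
  have 2: "realizes C y x A D \<delta>" "realizes C y' x' A' D' \<delta>'" using 1 by auto
  show "\<exists>b\<in>mor (opposite C) (tgt (opposite C) x) (tgt (opposite C) x').
       cmp (opposite C) b x = cmp (opposite C) x' a \<and> cmp (opposite C) y' b = cmp (opposite C) c y"
    using rz_morphism[OF 2(2,1), of c a] 1 realizesD[OF 2(1)] realizesD[OF 2(2)] by auto
next
  fix A D P i j p q assume "biproduct (opposite C) A D P i j p q"
  thus "realizes (opposite C) i q D A \<one>\<^bsub>Ext (opposite C) D A\<^esub>"
    using rz_zero[OF biproduct_swap, of A D P p q i j] by simp
next
  fix x y D A \<delta> x' y' D' A' \<delta>' PA iA iA' pA pA' PB iB iB' pB pB' PD iD iD' pD pD'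
  assume 1: "realizes (opposite C) x y D A \<delta>" "realizes (opposite C) x' y' D' A' \<delta>'"
    "biproduct (opposite C) A A' PA iA iA' pA pA'"
    "biproduct (opposite C) (tgt (opposite C) x) (tgt (opposite C) x') PB iB iB' pB pB'"
    "biproduct (opposite C) D D' PD iD iD' pD pD'"
  have 2: "realizes C y x A D \<delta>" "realizes C y' x' A' D' \<delta>'" using 1 by auto
  note D = realizesD[OF 2(1)] realizesD[OF 2(2)]
  have 3: "biproduct C A A' PA pA pA' iA iA'" "biproduct C D D' PD pD pD' iD iD'"
    "biproduct C (tgt C y) (tgt C y') PB pB pB' iB iB'" using 1 D by auto
  note B = biproductD(1-15)[OF 3(1)] biproductD(1-15)[OF 3(2)] biproductD(1-15)[OF 3(3)]
  have "mor_sum (opposite C) pA pA' iB iB' x x' = mor_sum C iB iB' pA pA' x x'"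
    "mor_sum (opposite C) pB pB' iD iD' y y' = mor_sum C iD iD' pB pB' y y'"
    using B D by (simp_all add: mor_sum_def)
  thus "realizes (opposite C) (mor_sum (opposite C) pA pA' iB iB' x x')
        (mor_sum (opposite C) pB pB' iD iD' y y') PD PA (ext_sum (opposite C) PD PA pD pD' iA iA' \<delta> \<delta>')"
    using rz_sum[OF 2 3(2,3,1)] by (simp add: ext_sum_def)
next
  fix x y D A \<delta> x' y' D' A' \<delta>' a b
  assume 1: "realizes (opposite C) x y D A \<delta>" "realizes (opposite C) x' y' D' A' \<delta>'"
    "a \<in> mor (opposite C) A A'" "b \<in> mor (opposite C) (tgt (opposite C) x) (tgt (opposite C) x')"
    "cmp (opposite C) b x = cmp (opposite C) x' a"
  have 2: "realizes C y x A D \<delta>" "realizes C y' x' A' D' \<delta>'" using 1 by auto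
  have "b \<in> mor C (tgt C y') (tgt C y)" "a \<in> mor C A' A" "a \<cdot> x' = x \<cdot> b"
    using 1 realizesD[OF 2(1)] realizesD[OF 2(2)] by simp_all
  then obtain c where "c \<in> mor C D' D" "b \<cdot> y' = y \<cdot> c" "push C A' c \<delta>' = pull C D a \<delta>"
    using ET3_op[OF 2(2,1), of b a] by blast
  thus "\<exists>c\<in>mor (opposite C) D D'. cmp (opposite C) c y = cmp (opposite C) y' b \<and>
          push (opposite C) D a \<delta> = pull (opposite C) A' c \<delta>'"
    by (intro bexI[of _ c]) simp_all
next
  fix x y D A \<delta> x' y' D' A' \<delta>' b c
  assume 1: "realizes (opposite C) x y D A \<delta>" "realizes (opposite C) x' y' D' A' \<delta>'"
    "b \<in> mor (opposite C) (tgt (opposite C) x) (tgt (opposite C) x')" "c \<in> mor (opposite C) D D'"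
    "cmp (opposite C) c y = cmp (opposite C) y' b"
  have 2: "realizes C y x A D \<delta>" "realizes C y' x' A' D' \<delta>'" using 1 by auto
  have "c \<in> mor C D' D" "b \<in> mor C (tgt C y') (tgt C y)" "b \<cdot> y' = y \<cdot> c"
    using 1 realizesD[OF 2(1)] realizesD[OF 2(2)] by simp_all
  then obtain a where "a \<in> mor C A' A" "a \<cdot> x' = x \<cdot> b" "push C A' c \<delta>' = pull C D a \<delta>"
    using ET3[OF 2(2,1), of c b] by blast
  thus "\<exists>a\<in>mor (opposite C) A A'. cmp (opposite C) b x = cmp (opposite C) x' a \<and>
          push (opposite C) D a \<delta> = pull (opposite C) A' c \<delta>'"
    by (intro bexI[of _ a]) simp_all
next
  fix f f' D A \<delta> g g' F B \<delta>'
  assume 1: "realizes (opposite C) f f' D A \<delta>" "realizes (opposite C) g g' F B \<delta>'" "tgt (opposite C) f = B"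
  show "\<exists>E\<in>obj (opposite C). \<exists>d\<in>mor (opposite C) D E. \<exists>e\<in>mor (opposite C) E F.
          \<exists>h'\<in>mor (opposite C) (tgt (opposite C) g) E. \<exists>\<delta>''\<in>carrier (Ext (opposite C) E A).
            cmp (opposite C) h' g = cmp (opposite C) d f' \<and> cmp (opposite C) e h' = g' \<and>
            realizes (opposite C) (cmp (opposite C) g f) h' E A \<delta>'' \<and>
            realizes (opposite C) d e F D (push (opposite C) F f' \<delta>') \<and>
            pull (opposite C) A d \<delta>'' = \<delta> \<and> push (opposite C) E f \<delta>'' = pull (opposite C) B e \<delta>'"
    using ET4_op[of f' f A D \<delta> g' g B F \<delta>'] 1 by simp
next
  fix f' f A D \<delta> g' g B F \<delta>'
  assume 1: "realizes (opposite C) f' f A D \<delta>" "realizes (opposite C) g' g B F \<delta>'" "src (opposite C) f = B"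
  show "\<exists>E\<in>obj (opposite C). \<exists>d\<in>mor (opposite C) E D. \<exists>e\<in>mor (opposite C) F E.
          \<exists>h'\<in>mor (opposite C) E (src (opposite C) g). \<exists>\<delta>''\<in>carrier (Ext (opposite C) A E).
            cmp (opposite C) g h' = cmp (opposite C) f' d \<and> cmp (opposite C) h' e = g' \<and>
            realizes (opposite C) h' (cmp (opposite C) f g) A E \<delta>'' \<and>
            realizes (opposite C) e d D F (pull (opposite C) F f' \<delta>') \<and>
            push (opposite C) A d \<delta>'' = \<delta> \<and> pull (opposite C) E f \<delta>'' = push (opposite C) B e \<delta>'"
    using ET4[of f f' D A \<delta> g g' F B \<delta>'] 1 by simp
qed (simp_all add: src_obj tgt_obj ident_mor cmp_mor cmp_ident_left cmp_ident_right
      cmp_assoc cmp_plus_left cmp_plus_right ex_zero_object Ext_comm_group Emap_hom Emap_ident Emap_cmp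
      push_plus pull_plus mor_iff)

end


section \<open>Exact sequences of a conflation\<close>

context extriangulated_category
begin

text \<open>
  Exactness of \<open>C(B,A') \<rightarrow> C(A,A') \<rightarrow> E(D,A')\<close>: if \<open>a\<^sub>*\<delta> = 0\<close>, then \<open>(a, 0)\<close> is a morphism
  from \<open>\<delta>\<close> to the zero extension realized by \<open>A' \<rightarrow> A' \<rightarrow> 0\<close>, and its middle component extends \<open>a\<close>.
\<close>

lemma extend_along_inflation:
  assumes "realizes C x y D A \<delta>" "a \<in> arr C" "src C a = A"
    "push C D a \<delta> = \<one>\<^bsub>Ext C D (tgt C a)\<^esub>"
  obtains b where "b \<in> arr C" "src C b = tgt C x" "tgt C b = tgt C a" "b \<cdot> x = a"
proof -
  note D = realizesD[OF assms(1)]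
  obtain Z where Z: "zero_object C Z" "Z \<in> obj C" by (rule obtain_zero_object)
  have "\<exists>b\<in>mor C (tgt C x) (tgt C (ident C (tgt C a))).
      b \<cdot> x = ident C (tgt C a) \<cdot> a \<and> zero_mor C (tgt C a) Z \<cdot> b = zero_mor C D Z \<cdot> y"
    by (rule rz_morphism[OF assms(1) realizes_ident(1)[OF Z(1), of "tgt C a"]])
      (use assms D Z in \<open>auto simp: mor_iff\<close>)
  thus thesis using assms that by (auto simp: mor_iff)
qed

lemma lift_along_deflation:
  assumes "realizes C x y D A \<delta>" "c \<in> arr C" "tgt C c = D"
    "pull C A c \<delta> = \<one>\<^bsub>Ext C (src C c) A\<^esub>"
  obtains b where "b \<in> arr C" "src C b = src C c" "tgt C b = src C y" "y \<cdot> b = c"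
  using extriangulated_category.extend_along_inflation[OF opposite_extriangulated, of y x A D \<delta> c thesis]
    assms by auto

lemma conflation_cmp_zero:
  assumes "realizes C x y D A \<delta>"
  shows "y \<cdot> x = zero_mor C A D"
proof -
  note D = realizesD[OF assms]
  obtain Z where Z: "zero_object C Z" "Z \<in> obj C" by (rule obtain_zero_object)
  have "\<exists>c \<in> mor C Z D. c \<cdot> zero_mor C A Z = y \<cdot> x \<and> push C Z (ident C A) \<one>\<^bsub>Ext C Z A\<^esub> = pull C A c \<delta>"
    by (rule ET3[OF realizes_ident(1)[OF Z(1) D(2)] assms]) (use D Z in \<open>auto simp: mor_iff\<close>)
  then obtain c where "c \<in> arr C" "src C c = Z" "tgt C c = D" "c \<cdot> zero_mor C A Z = y \<cdot> x"
    by (auto simp: mor_iff)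
  thus ?thesis using D by simp
qed

text \<open>
  Exactness of \<open>C(X,A) \<rightarrow> C(X,B) \<rightarrow> C(X,D)\<close>: apply the dual of (ET3) to \<open>X \<rightarrow> X \<rightarrow> 0\<close> and the
  given conflation.
\<close>

lemma factor_through_inflation:
  assumes "realizes C x y D A \<delta>" "g \<in> arr C" "tgt C g = src C y" "y \<cdot> g = zero_mor C (src C g) D"
  obtains s where "s \<in> arr C" "src C s = src C g" "tgt C s = A" "x \<cdot> s = g"
proof -
  note D = realizesD[OF assms(1)]
  obtain Z where Z: "zero_object C Z" "Z \<in> obj C" by (rule obtain_zero_object)
  have "\<exists>a\<in>mor C (src C g) A. g \<cdot> ident C (src C g) = x \<cdot> a \<and>
     push C Z a \<one>\<^bsub>Ext C Z (src C g)\<^esub> = pull C A (zero_mor C Z D) \<delta>"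
    by (rule ET3_op[OF realizes_ident(1)[OF Z(1)] assms(1)]) (use assms D Z in \<open>auto simp: mor_iff\<close>)
  thus thesis using assms that by (auto simp: mor_iff)
qed

lemma push_inflation:
  assumes "realizes C x y D A \<delta>"
  shows "push C D x \<delta> = \<one>\<^bsub>Ext C D (tgt C x)\<^esub>"
proof -
  note D = realizesD[OF assms]
  obtain Z where Z: "zero_object C Z" "Z \<in> obj C" by (rule obtain_zero_object)
  have "\<exists>a\<in>mor C A (tgt C x). ident C (tgt C x) \<cdot> x = ident C (tgt C x) \<cdot> a \<and>
     push C D a \<delta> = pull C (tgt C x) (zero_mor C D Z) \<one>\<^bsub>Ext C Z (tgt C x)\<^esub>"
    by (rule ET3_op[OF assms realizes_ident(1)[OF Z(1)]]) (use assms D Z in \<open>auto simp: mor_iff\<close>)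
  then obtain a where "a \<in> arr C" "src C a = A" "tgt C a = tgt C x" "x = a"
     "push C D a \<delta> = pull C (tgt C x) (zero_mor C D Z) \<one>\<^bsub>Ext C Z (tgt C x)\<^esub>"
    using D by (auto simp: mor_iff)
  thus ?thesis using D Z by simp
qed

lemma pull_deflation:
  assumes "realizes C x y D A \<delta>"
  shows "pull C A y \<delta> = \<one>\<^bsub>Ext C (src C y) A\<^esub>"
  using extriangulated_category.push_inflation[OF opposite_extriangulated, of y x A D \<delta>] assms by simp

lemma ET4_op_obtain:
  assumes "realizes C f' f A D \<delta>" "realizes C g' g B F \<delta>'" "src C f = B"
  obtains E d e h \<delta>'' where "E \<in> obj C" "d \<in> arr C" "src C d = E" "tgt C d = D"
    "e \<in> arr C" "src C e = F" "tgt C e = E" "h \<in> arr C" "src C h = E" "tgt C h = src C g"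
    "\<delta>'' \<in> carrier (Ext C A E)" "g \<cdot> h = f' \<cdot> d" "h \<cdot> e = g'"
    "realizes C h (f \<cdot> g) A E \<delta>''" "realizes C e d D F (pull C F f' \<delta>')"
    "push C A d \<delta>'' = \<delta>" "pull C E f \<delta>'' = push C B e \<delta>'"
proof -
  obtain E d e h \<delta>'' where "E \<in> obj C" "d \<in> mor C E D" "e \<in> mor C F E" "h \<in> mor C E (src C g)"
    "\<delta>'' \<in> carrier (Ext C A E)" "g \<cdot> h = f' \<cdot> d" "h \<cdot> e = g'"
    "realizes C h (f \<cdot> g) A E \<delta>''" "realizes C e d D F (pull C F f' \<delta>')"
    "push C A d \<delta>'' = \<delta>" "pull C E f \<delta>'' = push C B e \<delta>'"
    using ET4_op[OF assms] by blast
  thus thesis by (intro that[of E d e h \<delta>'']) (simp_all add: mor_iff)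
qed

text \<open>
  Exactness of \<open>E(D,V) \<rightarrow> E(B,V) \<rightarrow> E(A,V)\<close> in the middle. Realize \<open>\<theta>\<close> by \<open>V \<rightarrow> W \<rightarrow> B\<close>. The composed
  deflation \<open>W \<rightarrow> B \<rightarrow> D\<close> has as its cocone an extension \<open>V \<rightarrow> E \<rightarrow> A\<close> of class \<open>x\<^sup>*\<theta> = 0\<close>, so \<open>V \<rightarrow> E\<close>
  has a retraction \<open>r\<close>. By the compatibility in the dual of (ET4), the image of \<open>\<theta>\<close> in \<open>E(B,E)\<close> is pulled back
  from \<open>D\<close>, and \<open>r\<^sub>*\<close> transports this back to \<open>\<theta>\<close>.
\<close>

lemma ext_factor_through_deflation:
  assumes "realizes C x y D A \<delta>" "V \<in> obj C" "\<theta> \<in> carrier (Ext C (tgt C x) V)"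
    "pull C V x \<theta> = \<one>\<^bsub>Ext C A V\<^esub>"
  obtains \<theta>' where "\<theta>' \<in> carrier (Ext C D V)" "\<theta> = pull C V y \<theta>'"
proof -
  note D = realizesD[OF assms(1)]
  have B: "tgt C x \<in> obj C" using D by simp
  obtain v w where vw: "realizes C v w (tgt C x) V \<theta>" using B assms(2,3) by (rule ex_realization)
  obtain E d e h \<delta>' where E: "E \<in> obj C" "d \<in> arr C" "e \<in> arr C" "src C d = E" "src C e = V" "tgt C e = E"
    "\<delta>' \<in> carrier (Ext C D E)" "realizes C e d A V (pull C V x \<theta>)" "pull C E y \<delta>' = push C (tgt C x) e \<theta>"
    using ET4_op_obtain[OF assms(1) vw] D by metis
  obtain r where r: "r \<in> arr C" "src C r = E" "tgt C r = V" "r \<cdot> e = ident C V"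
    by (rule extend_along_inflation[OF E(8), of "ident C V"]) (use assms E D in auto)
  have "\<theta> = push C (tgt C x) (r \<cdot> e) \<theta>" using r assms B by simp
  also have "\<dots> = push C (tgt C x) r (pull C E y \<delta>')" using r assms(2,3) E B by (subst push_cmp) auto
  also have "\<dots> = pull C V y (push C D r \<delta>')" using r E D by (subst push_pull_commute) auto
  finally show thesis using that[of "push C D r \<delta>'"] r E D by simp
qed

text \<open>
  The zero extension is also realized by a direct sum, and a realization is unique up to an
  isomorphism of middle terms.
\<close>

lemma split_conflation:
  assumes "realizes C x y D A \<one>\<^bsub>Ext C D A\<^esub>"
  obtains j p where "biproduct C A D (tgt C x) x j p y"
proof -
  note D = realizesD[OF assms]
  obtain P i j p q where P: "biproduct C A D P i j p q" using ex_biproduct[OF D(2,1)] by blast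
  obtain b where b: "iso_mor C b" "b \<in> arr C" "src C b = src C q" "tgt C b = src C y" "b \<cdot> i = x" "y \<cdot> b = q"
    using realizes_unique[OF rz_zero[OF P] assms] by (rule seq_relD)
  obtain c where c: "c \<in> arr C" "src C c = tgt C b" "tgt C c = src C b"
    "c \<cdot> b = ident C (src C b)" "b \<cdot> c = ident C (tgt C b)" "iso_mor C c"
    using b(1) by (rule iso_morE)
  note PD = biproductD[OF P]
  have "biproduct C A D (tgt C x) (b \<cdot> i) (b \<cdot> j) (p \<cdot> c) (q \<cdot> c)"
    by (rule biproduct_iso[OF P]) (use b c D PD in auto)
  moreover have "q \<cdot> c = y" unfolding b(6)[symmetric] using b(1-4) c D by simp
  ultimately show thesis using that b by auto
qed

text \<open>
  This makes an endomorphism of a cone that is compatible with the deflation and with the extension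
  invertible. Put \<open>n = 1 - e\<close>. As \<open>n\<^sup>*\<delta> = 0\<close>, \<open>n\<close> factors as \<open>y \<cdot> v\<close>, and \<open>n \<cdot> y = 0\<close>, so \<open>n\<close> squares to
  zero and \<open>1 + n\<close> is inverse to \<open>e\<close>.
\<close>

lemma cone_comparison_iso:
  assumes "realizes C x y D A \<delta>" "e \<in> arr C" "src C e = D" "tgt C e = D"
    "e \<cdot> y = y" "pull C A e \<delta> = \<delta>"
  obtains e' where "e' \<in> arr C" "src C e' = D" "tgt C e' = D" "e' \<cdot> e = ident C D" "e \<cdot> e' = ident C D"
proof -
  note D = realizesD[OF assms(1)]
  define n where "n = ident C D \<boxplus> neg C e"
  have n: "n \<in> arr C" "src C n = D" "tgt C n = D" using assms D by (auto simp: n_def)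
  have "pull C A n \<delta> = \<one>\<^bsub>Ext C D A\<^esub>"
    unfolding n_def using pull_diff_eq_one[of A "ident C D" e \<delta>] assms D by simp
  then obtain v where v: "v \<in> arr C" "src C v = D" "tgt C v = src C y" "y \<cdot> v = n"
    using lift_along_deflation[OF assms(1), of n] n by auto
  have "n \<cdot> y = zero_mor C (src C y) D" unfolding n_def using assms D by simp
  hence "n \<cdot> (y \<cdot> v) = zero_mor C (src C y) D \<cdot> v"
    by (rule cmp_cong_left) (use v(1-3) n D in simp_all)
  hence nn: "n \<cdot> n = zero_mor C D D" using v(1-3) D by (simp add: v(4))
  have e: "ident C D = n \<boxplus> e" unfolding n_def using minus_plus_cancel(1)[of "ident C D" e] assms D by simp
  have ne: "n \<cdot> e = n"
  proof -
    have "n = n \<cdot> (n \<boxplus> e)" using n D unfolding e[symmetric] by simp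
    thus ?thesis using n assms(2-4) nn D by simp
  qed
  have en: "e \<cdot> n = n"
  proof -
    have "n = (n \<boxplus> e) \<cdot> n" using n D unfolding e[symmetric] by simp
    thus ?thesis using n assms(2-4) nn D by simp
  qed
  show thesis
  proof (rule that[of "ident C D \<boxplus> n"])
    have "(ident C D \<boxplus> n) \<cdot> e = e \<boxplus> n" "e \<cdot> (ident C D \<boxplus> n) = e \<boxplus> n"
      using n assms(2-4) D ne en by simp_all
    moreover have "e \<boxplus> n = ident C D" unfolding e using n assms(2-4) by (intro plus_comm) auto
    ultimately show "(ident C D \<boxplus> n) \<cdot> e = ident C D" "e \<cdot> (ident C D \<boxplus> n) = ident C D"
      by simp_all
  qed (use n D in auto)
qed

text \<open>
  (ET3) gives comparison maps between two cones of the same inflation in both directions. Both of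
  their composites are invertible by the previous lemma, hence so are the maps themselves.
\<close>

lemma cones_isomorphic:
  assumes "realizes C x y D A \<delta>" "realizes C x y' D' A \<delta>'"
  shows "isomorphic_obj C D D'"
proof -
  note D = realizesD[OF assms(1)] realizesD[OF assms(2)]
  have ex: "\<exists>c. c \<in> arr C \<and> src C c = E \<and> tgt C c = E' \<and> c \<cdot> z = z' \<and> \<epsilon> = pull C A c \<epsilon>'"
    if "realizes C x z E A \<epsilon>" "realizes C x z' E' A \<epsilon>'" for z z' E E' \<epsilon> \<epsilon>'
  proof -
    note R = realizesD[OF that(1)] realizesD[OF that(2)]
    have "\<exists>c\<in>mor C E E'. c \<cdot> z = z' \<cdot> ident C (tgt C x) \<and> push C E (ident C A) \<epsilon> = pull C A c \<epsilon>'"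
      by (rule ET3[OF that]) (use R in \<open>auto simp: mor_iff\<close>)
    thus ?thesis using R by (simp add: mor_iff Bex_def conj_assoc)
  qed
  obtain c where c: "c \<in> arr C" "src C c = D" "tgt C c = D'" "c \<cdot> y = y'" "\<delta> = pull C A c \<delta>'"
    using ex[OF assms] by blast
  obtain c' where c': "c' \<in> arr C" "src C c' = D'" "tgt C c' = D" "c' \<cdot> y' = y" "\<delta>' = pull C A c' \<delta>"
    using ex[OF assms(2,1)] by blast
  obtain u where u: "u \<in> arr C" "src C u = D" "tgt C u = D" "u \<cdot> (c' \<cdot> c) = ident C D"
    by (rule cone_comparison_iso[OF assms(1), of "c' \<cdot> c"])
      (use c c' D pull_cmp[of A c' c \<delta>] in simp_all)
  obtain v where v: "v \<in> arr C" "src C v = D'" "tgt C v = D'" "(c \<cdot> c') \<cdot> v = ident C D'"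
    by (rule cone_comparison_iso[OF assms(2), of "c \<cdot> c'"])
      (use c c' D pull_cmp[of A c c' \<delta>'] in simp_all)
  have l: "(u \<cdot> c') \<cdot> c = ident C D" using u c c' by simp
  have r: "c \<cdot> (c' \<cdot> v) = ident C D'" using v c c' by simp
  have "u \<cdot> c' = (u \<cdot> c') \<cdot> (c \<cdot> (c' \<cdot> v))" unfolding r using u c c' D by simp
  also have "\<dots> = ((u \<cdot> c') \<cdot> c) \<cdot> (c' \<cdot> v)" using u(1-3) v(1-3) c(1-3) c'(1-3) by simp
  also have "\<dots> = c' \<cdot> v" unfolding l using v c c' D by simp
  finally have "iso_mor C c" using c c' u v l r by (intro iso_morI[of _ "u \<cdot> c'"]) auto
  thus ?thesis by (rule isomorphic_objI) (use c in auto)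
qed

lemma isomorphic_obj_opposite [simp]: "isomorphic_obj (opposite C) A B \<longleftrightarrow> isomorphic_obj C A B"
  using isomorphic_sym by (auto simp: isomorphic_obj_def)

lemma is_Cone_isomorphic:
  assumes "is_Cone C f D" "is_Cone C f D'"
  shows "isomorphic_obj C D D'"
  using assms cones_isomorphic by (auto simp: is_Cone_def conflation_def)

end

section \<open>Compositions and pushouts of conflations\<close>

context extriangulated_category
begin

lemma realizes_conflation: "realizes C x y D A \<delta> \<Longrightarrow> conflation C x y"
  using realizesD[of x y D A \<delta>] by (auto simp: conflation_def)

lemma conflationE:
  assumes "conflation C x y"
  obtains \<delta> where "realizes C x y (tgt C y) (src C x) \<delta>" "x \<in> arr C" "y \<in> arr C" "tgt C x = src C y"
  using assms realizesD unfolding conflation_def by metis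

lemma deflation_cmp:
  assumes "realizes C x y D A \<delta>" "realizes C x' y' (src C y) A' \<delta>'"
  shows "deflation C (y \<cdot> y')"
proof -
  obtain E d e h \<delta>'' where "realizes C h (y \<cdot> y') D E \<delta>''"
    using ET4_op_obtain[OF assms refl] by metis
  thus ?thesis unfolding deflation_def using realizes_conflation by blast
qed

text \<open>
  (ET4) without the compatibilities of the extensions: the cone of a composition of inflations is
  an extension of the second cone by the first.
\<close>

lemma inflation_cmp:
  assumes "realizes C x y D A \<delta>" "realizes C x' y' D' (tgt C x) \<delta>'"
  obtains h d e where "conflation C (x' \<cdot> x) h" "conflation C d e" "tgt C h = tgt C d"
    "src C d = D" "tgt C e = D'"
proof -
  obtain E d e h \<delta>'' where E: "d \<in> mor C D E" "realizes C (x' \<cdot> x) h E A \<delta>''"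
     "realizes C d e D' D (push C D' y \<delta>')"
    using ET4[OF assms refl] by blast
  thus thesis using that[of h d e] realizes_conflation realizesD[OF E(2)] realizesD[OF E(3)]
    by (simp add: mor_iff)
qed

text \<open>
  Two extensions \<open>\<delta>1\<close>, \<open>\<delta>2\<close> of \<open>C1\<close> and \<open>C2\<close> by the same object \<open>A\<close> give the extension
  \<open>p1\<^sup>*\<delta>1 + p2\<^sup>*\<delta>2\<close> of \<open>C1 \<oplus> C2\<close> by \<open>A\<close>. Its middle term \<open>M\<close> serves as the pushout of the two
  inflations: by the dual of (ET4), the cocone of \<open>M \<rightarrow> C1 \<oplus> C2 \<rightarrow> C2\<close> is an extension of \<open>C1\<close> by \<open>A\<close>
  of class \<open>i1\<^sup>*(p1\<^sup>*\<delta>1 + p2\<^sup>*\<delta>2) = \<delta>1\<close>, so it is isomorphic to the middle term of \<open>\<delta>1\<close>. The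
  isomorphism \<open>b\<close> is kept in the statement since the class of sequences realizing an
  extension is by definition invariant under isomorphisms of the middle term only.
\<close>

lemma pushout_inflation:
  assumes "realizes C x1 y1 C1 A \<delta>1" "\<delta>2 \<in> carrier (Ext C C2 A)" and P: "biproduct C C1 C2 P i1 i2 p1 p2"
    and mn: "realizes C m n P A (pull C A p1 \<delta>1 \<otimes>\<^bsub>Ext C P A\<^esub> pull C A p2 \<delta>2)"
  obtains b u \<delta> where "iso_mor C b" "b \<in> arr C" "src C b = tgt C x1" "tgt C b = src C u"
    "realizes C u (p2 \<cdot> n) C2 (src C u) \<delta>" "(p1 \<cdot> n) \<cdot> (u \<cdot> b) = y1"
proof -
  note D = realizesD[OF assms(1)] and B = biproductD[OF P] and M = realizesD[OF mn]
  obtain E d e h \<delta>'' where E: "E \<in> obj C" "d \<in> arr C" "src C d = E" "tgt C d = C1"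
    "e \<in> arr C" "src C e = A" "tgt C e = E" "h \<in> arr C" "src C h = E" "tgt C h = src C n"
    "n \<cdot> h = i1 \<cdot> d" "realizes C h (p2 \<cdot> n) C2 E \<delta>''"
    "realizes C e d C1 A (pull C A i1 (pull C A p1 \<delta>1 \<otimes>\<^bsub>Ext C P A\<^esub> pull C A p2 \<delta>2))"
    by (rule ET4_op_obtain[OF rz_zero[OF P] mn]) (use B in simp_all)
  interpret G: group "Ext C C1 A" by (rule Ext_group) (use D in simp_all)
  have "pull C A i1 (pull C A p1 \<delta>1 \<otimes>\<^bsub>Ext C P A\<^esub> pull C A p2 \<delta>2)
      = pull C A i1 (pull C A p1 \<delta>1) \<otimes>\<^bsub>Ext C C1 A\<^esub> pull C A i1 (pull C A p2 \<delta>2)"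
    using pull_mult[of A i1 "pull C A p1 \<delta>1" "pull C A p2 \<delta>2"] B D assms(2) by simp
  also have "\<dots> = pull C A (p1 \<cdot> i1) \<delta>1 \<otimes>\<^bsub>Ext C C1 A\<^esub> pull C A (p2 \<cdot> i1) \<delta>2"
    using B(1-15) D assms(2) by (subst (1 2) pull_cmp) simp_all
  also have "\<dots> = \<delta>1" using B D assms(2) by simp
  finally have ed: "realizes C e d C1 A \<delta>1" using E(13) by simp
  obtain b where b: "iso_mor C b" "b \<in> arr C" "src C b = src C y1" "tgt C b = src C d" "b \<cdot> x1 = e" "d \<cdot> b = y1"
    using realizes_unique[OF assms(1) ed] by (rule seq_relD)
  have "(p1 \<cdot> n) \<cdot> (h \<cdot> b) = p1 \<cdot> ((n \<cdot> h) \<cdot> b)" using b(2-4) E(1-10) B(1-15) M by simp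
  also have "\<dots> = (p1 \<cdot> i1) \<cdot> (d \<cdot> b)" unfolding E(11) using b(2-4) E(1-10) B(1-15) M by simp
  also have "\<dots> = y1" unfolding b(6) B(16) using D by simp
  finally show thesis using that[of b h] b(1-4) E(9,12) E(3) D(7) by simp
qed

text \<open>
  The previous lemma applied to both projections of \<open>C1 \<oplus> C2\<close>.
\<close>

lemma pushout_of_conflations:
  assumes "realizes C x1 y1 C1 A \<delta>1" "realizes C x2 y2 C2 A \<delta>2"
  obtains b u v \<delta> w z where "iso_mor C b" "b \<in> arr C" "src C b = tgt C x1" "tgt C b = src C u"
    "realizes C u v C2 (src C u) \<delta>" "conflation C w z" "isomorphic_obj C (tgt C x2) (src C w)"
    "z \<cdot> (u \<cdot> b) = y1" "tgt C u = src C z" "tgt C z = C1"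
proof -
  note D = realizesD[OF assms(1)] realizesD[OF assms(2)]
  obtain P i1 i2 p1 p2 where P: "biproduct C C1 C2 P i1 i2 p1 p2" using ex_biproduct D(1,9) by blast
  note B = biproductD[OF P]
  interpret G: comm_group "Ext C P A" by (rule Ext_comm_group) (use B D in simp_all)
  have c: "pull C A p1 \<delta>1 \<in> carrier (Ext C P A)" "pull C A p2 \<delta>2 \<in> carrier (Ext C P A)"
    using B D by simp_all
  obtain m n where mn: "realizes C m n P A (pull C A p1 \<delta>1 \<otimes>\<^bsub>Ext C P A\<^esub> pull C A p2 \<delta>2)"
    using B(3) D(2) G.m_closed[OF c] by (rule ex_realization)
  obtain b u \<delta> where b: "iso_mor C b" "b \<in> arr C" "src C b = tgt C x1" "tgt C b = src C u"
    "realizes C u (p2 \<cdot> n) C2 (src C u) \<delta>" "(p1 \<cdot> n) \<cdot> (u \<cdot> b) = y1"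
    using assms(1) D(11) P mn by (rule pushout_inflation)
  have mn': "realizes C m n P A (pull C A p2 \<delta>2 \<otimes>\<^bsub>Ext C P A\<^esub> pull C A p1 \<delta>1)"
    using mn G.m_comm[OF c] by simp
  obtain b' w \<delta>' where w: "iso_mor C b'" "b' \<in> arr C" "src C b' = tgt C x2" "tgt C b' = src C w"
    "realizes C w (p1 \<cdot> n) C1 (src C w) \<delta>'"
    using assms(2) D(3) biproduct_swap[OF P] mn' by (rule pushout_inflation)
  have "isomorphic_obj C (tgt C x2) (src C w)" using w(1-4) by (rule isomorphic_objI)
  moreover have "tgt C u = src C (p1 \<cdot> n)"
    using realizesD[OF b(5)] realizesD[OF mn] B by simp
  ultimately show thesis
    using that[OF b(1-5) realizes_conflation[OF w(5)]] realizesD(8)[OF w(5)] b(6) by simp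
qed

text \<open>
  For \<open>h : A \<rightarrow> D\<close> and a deflation \<open>y : B \<rightarrow> D\<close>, the row \<open>(y, h) : B \<oplus> A \<rightarrow> D\<close> is the composition of
  \<open>y \<oplus> 1 : B \<oplus> A \<rightarrow> D \<oplus> A\<close>, a direct sum of deflations, with the split deflation
  \<open>(1, h) : D \<oplus> A \<rightarrow> D\<close>.
\<close>

lemma deflation_row:
  assumes "realizes C x y D V \<delta>" "h \<in> arr C" "tgt C h = D"
  obtains w e P i j p q \<epsilon> where "realizes C w e D (src C w) \<epsilon>" "biproduct C (src C y) (src C h) P i j p q"
    "src C e = P" "e \<cdot> j = h"
proof -
  note D = realizesD[OF assms(1)]
  have A: "src C h \<in> obj C" using assms by simp
  obtain Z where Z: "zero_object C Z" "Z \<in> obj C" by (rule obtain_zero_object)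
  obtain P i j p q where P: "biproduct C (src C y) (src C h) P i j p q"
    using ex_biproduct[OF src_in_obj[OF D(5)] A] by blast
  obtain Q i' j' p' q' where Q: "biproduct C D (src C h) Q i' j' p' q'"
    using ex_biproduct[OF D(1) A] by blast
  note PD = biproductD[OF P] and QD = biproductD[OF Q]
  have 1: "biproduct C (tgt C x) (tgt C (zero_mor C Z (src C h))) P i j p q" using P D Z A by simp
  let ?s = "mor_sum C p q i' j' y (ident C (src C h))"
  obtain w' A' \<epsilon>' where s: "realizes C w' ?s Q A' \<epsilon>'"
    using rz_sum[OF assms(1) realizes_ident(2)[OF Z(1) A] biproduct_zero_right[OF Z(1) D(2)] 1 Q] by blast
  \<comment> \<open>The shear of \<open>Q\<close> along \<open>h\<close> turns \<open>(1, h)\<close> into a projection.\<close>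
  have t: "biproduct C (src C h) D Q (j' \<boxplus> neg C (i' \<cdot> h)) i' q' (p' \<boxplus> h \<cdot> q')"
  proof (rule biproductI)
    have n: "neg C (i' \<cdot> h) \<cdot> q' = neg C (i' \<cdot> (h \<cdot> q'))"
      using QD(1-15) assms(2,3) by simp
    have c: "i' \<cdot> (h \<cdot> q') \<in> arr C" "src C (i' \<cdot> (h \<cdot> q')) = Q" "tgt C (i' \<cdot> (h \<cdot> q')) = Q"
      "j' \<cdot> q' \<in> arr C" "i' \<cdot> p' \<in> arr C" "src C (j' \<cdot> q') = Q" "tgt C (j' \<cdot> q') = Q"
      "src C (i' \<cdot> p') = Q" "tgt C (i' \<cdot> p') = Q"
      using QD(1-15) assms(2,3) by simp_all
    have "(j' \<boxplus> neg C (i' \<cdot> h)) \<cdot> q' \<boxplus> i' \<cdot> (p' \<boxplus> h \<cdot> q')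
        = (j' \<cdot> q' \<boxplus> neg C (i' \<cdot> (h \<cdot> q'))) \<boxplus> (i' \<cdot> p' \<boxplus> i' \<cdot> (h \<cdot> q'))"
      using QD(1-15) assms(2,3) by simp
    also have "\<dots> = (j' \<cdot> q' \<boxplus> neg C (i' \<cdot> (h \<cdot> q'))) \<boxplus> (i' \<cdot> (h \<cdot> q') \<boxplus> i' \<cdot> p')"
      using c plus_comm[of "i' \<cdot> p'" "i' \<cdot> (h \<cdot> q')"] by simp
    also have "\<dots> = ((j' \<cdot> q' \<boxplus> neg C (i' \<cdot> (h \<cdot> q'))) \<boxplus> i' \<cdot> (h \<cdot> q')) \<boxplus> i' \<cdot> p'"
      by (rule plus_assoc[symmetric]) (use c in simp_all)
    also have "\<dots> = j' \<cdot> q' \<boxplus> i' \<cdot> p'"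
      using minus_plus_cancel(1)[of "j' \<cdot> q'" "i' \<cdot> (h \<cdot> q')"] c by simp
    also have "\<dots> = ident C Q" using QD(20) c plus_comm[of "j' \<cdot> q'" "i' \<cdot> p'"] by simp
    finally show "(j' \<boxplus> neg C (i' \<cdot> h)) \<cdot> q' \<boxplus> i' \<cdot> (p' \<boxplus> h \<cdot> q') = ident C Q" .
    show "q' \<cdot> (j' \<boxplus> neg C (i' \<cdot> h)) = ident C (src C h)"
      using QD(1-19) assms(2,3) cmp_cong_left[OF QD(18), of h] minus_eq_iff by simp
    show "(p' \<boxplus> h \<cdot> q') \<cdot> (j' \<boxplus> neg C (i' \<cdot> h)) = zero_mor C (src C h) D"
      using QD(1-19) assms(2,3) cmp_cong_left[OF QD(18), of h] cmp_cong_left[OF QD(16), of h] by simp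
  qed (use QD assms(2,3) in simp_all)
  let ?e = "(p' \<boxplus> h \<cdot> q') \<cdot> ?s"
  have sD: "?s \<in> arr C" "src C ?s = P" "tgt C ?s = Q"
    using PD(1-15) QD(1-15) D A by (simp_all add: mor_sum_def)
  have sj: "?s \<cdot> j = j'"
    using PD QD(1-15) D A by (simp add: mor_sum_def)
  have "deflation C ?e"
    by (rule deflation_cmp[OF rz_zero[OF t]]) (use s QD assms(2,3) in simp)
  then obtain w where w: "conflation C w ?e" by (auto simp: deflation_def)
  then obtain \<epsilon> where "realizes C w ?e (tgt C ?e) (src C w) \<epsilon>" by (rule conflationE)
  moreover have e: "src C ?e = P" "tgt C ?e = D" using sD QD assms by simp_all
  moreover have "?e \<cdot> j = h"
  proof -
    have "?e \<cdot> j = (p' \<boxplus> h \<cdot> q') \<cdot> (?s \<cdot> j)" using sD QD(1-15) PD(1-15) assms(2,3) by simp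
    also have "\<dots> = h" unfolding sj using QD assms(2,3) by simp
    finally show ?thesis .
  qed
  ultimately show thesis using that[of w ?e \<epsilon> P i j p q] P by simp
qed

end


section \<open>Weak idempotent completeness\<close>

text \<open>
  Every retract has a complement. Unlike the existence of cokernels of split monomorphisms, to
  which it is equivalent, this form is visibly self-dual.
\<close>

locale wic_extriangulated_category = extriangulated_category C
  for C :: "('o, 'm, 'e, 'z) extri_scheme" (structure) +
  assumes retract_complement: "\<lbrakk>s \<in> arr C; r \<in> arr C; src C r = tgt C s; tgt C r = src C s;
      r \<cdot> s = ident C (src C s)\<rbrakk> \<Longrightarrow> \<exists>K k \<pi>. biproduct C (src C s) K (tgt C s) s k r \<pi>"

lemma (in wic_extriangulated_category) opposite_wic: "wic_extriangulated_category (opposite C)"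
proof (intro wic_extriangulated_category.intro opposite_extriangulated
    wic_extriangulated_category_axioms.intro)
  fix s r assume "s \<in> arr (opposite C)" "r \<in> arr (opposite C)"
    "src (opposite C) r = tgt (opposite C) s" "tgt (opposite C) r = src (opposite C) s"
    "cmp (opposite C) r s = ident (opposite C) (src (opposite C) s)"
  hence "\<exists>K k \<pi>. biproduct C (src C r) K (tgt C r) r k s \<pi>" and "src C r = tgt C s" "tgt C r = src C s"
    using retract_complement[of r s] by simp_all
  thus "\<exists>K k \<pi>. biproduct (opposite C) (src (opposite C) s) K (tgt (opposite C) s) s k r \<pi>"
    by simp blast
qed

text \<open>
  The complement of \<open>s\<close> is its cokernel \<open>\<pi>\<close>: the idempotent \<open>1 - s \<cdot> r\<close> vanishes on \<open>s\<close>, so it is of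
  the form \<open>k \<cdot> \<pi>\<close>, and \<open>k\<close> is the second inclusion.
\<close>

lemma (in extriangulated_category) weakly_idempotent_complete_wic:
  assumes "weakly_idempotent_complete C"
  shows "wic_extriangulated_category C"
proof (intro wic_extriangulated_category.intro wic_extriangulated_category_axioms.intro)
  show "extriangulated_category C" by (rule extriangulated_category_axioms)
  fix s r assume a: "s \<in> arr C" "r \<in> arr C" "src C r = tgt C s" "tgt C r = src C s"
    "r \<cdot> s = ident C (src C s)"
  have "split_mono C s" using a by (auto simp: split_mono_def mor_iff intro!: bexI[of _ r])
  then obtain \<pi> where "is_cokernel C s \<pi>"
    using assms by (auto simp: weakly_idempotent_complete_def)
  hence p: "\<pi> \<in> arr C" "src C \<pi> = tgt C s" "\<pi> \<cdot> s = zero_mor C (src C s) (tgt C \<pi>)"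
    and un: "\<And>X g. \<lbrakk>X \<in> obj C; g \<in> mor C (tgt C s) X; g \<cdot> s = zero_mor C (src C s) X\<rbrakk>
      \<Longrightarrow> \<exists>!u. u \<in> mor C (tgt C \<pi>) X \<and> u \<cdot> \<pi> = g"
    by (auto simp: is_cokernel_def)
  define e where "e = ident C (tgt C s) \<boxplus> neg C (s \<cdot> r)"
  have e: "e \<in> arr C" "src C e = tgt C s" "tgt C e = tgt C s" using a by (simp_all add: e_def)
  have es: "e \<cdot> s = zero_mor C (src C s) (tgt C s)" using a by (simp add: e_def)
  have re: "r \<cdot> e = zero_mor C (tgt C s) (src C s)"
    using a cmp_cong_left[OF a(5), of r] by (simp add: e_def)
  have pe: "\<pi> \<cdot> e = \<pi>" using a p cmp_cong_left[OF p(3), of r]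
      minus_eq_iff[of \<pi> "zero_mor C (tgt C s) (tgt C \<pi>)" \<pi>] by (simp add: e_def)
  obtain k where k: "k \<in> arr C" "src C k = tgt C \<pi>" "tgt C k = tgt C s" "k \<cdot> \<pi> = e"
    using un[of "tgt C s" e] e es a by (auto simp: mor_iff)
  have "(\<pi> \<cdot> k) \<cdot> \<pi> = \<pi>" using k p pe by simp
  hence pk: "\<pi> \<cdot> k = ident C (tgt C \<pi>)"
    using un[of "tgt C \<pi>" \<pi>] p(1,2,3) k(1-3) by (metis mor_iff cmp_arr cmp_id(2) ident_arr tgt_in_obj)
  have "(r \<cdot> k) \<cdot> \<pi> = zero_mor C (tgt C s) (src C s)" using k p re a by simp
  moreover have "zero_mor C (tgt C \<pi>) (src C s) \<cdot> \<pi> = zero_mor C (tgt C s) (src C s)" using p a by simp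
  moreover have "zero_mor C (tgt C s) (src C s) \<cdot> s = zero_mor C (src C s) (src C s)" using a by simp
  ultimately have rk: "r \<cdot> k = zero_mor C (tgt C \<pi>) (src C s)"
    using un[of "src C s" "zero_mor C (tgt C s) (src C s)"] p(1,2) k(1-3) a(1-4)
    by (metis mor_iff cmp_arr zero_arr tgt_in_obj src_in_obj)
  have "s \<cdot> r \<boxplus> k \<cdot> \<pi> = ident C (tgt C s)"
    unfolding k(4) e_def by (rule minus_plus_cancel(2)) (use a in simp_all)
  hence "biproduct C (src C s) (tgt C \<pi>) (tgt C s) s k r \<pi>"
    using a p k pk rk by (intro biproductI) simp_all
  thus "\<exists>K k \<pi>. biproduct C (src C s) K (tgt C s) s k r \<pi>" by blast
qed

context wic_extriangulated_category
begin

text \<open>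
  If \<open>r \<cdot> t\<close> is a deflation, where \<open>t\<close> has a section \<open>f\<close>, then \<open>r\<close> is one, and its cocone is a direct
  summand of the cocone \<open>W\<close> of \<open>r \<cdot> t\<close>. Write the source of \<open>t\<close> as \<open>A \<oplus> U\<close> with \<open>t\<close> the projection to
  \<open>A\<close>. Since \<open>r \<cdot> t\<close> kills \<open>U\<close>, the inclusion of \<open>U\<close> factors through \<open>W\<close>, and it splits there:
  \<open>W = K \<oplus> U\<close>. The extension \<open>\<epsilon>\<close> lives on \<open>K\<close> alone, because its \<open>U\<close>-component factors through
  \<open>w\<^sub>*\<epsilon> = 0\<close>. Hence \<open>K \<oplus> U \<rightarrow> A \<oplus> U \<rightarrow> B\<close> is, up to an isomorphism \<open>\<phi>\<close> of middle terms, the direct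
  sum of a conflation \<open>K \<rightarrow> Y \<rightarrow> B\<close> and of \<open>U \<rightarrow> U \<rightarrow> 0\<close>. As \<open>\<phi>\<close> is the identity on \<open>U\<close>, it induces an
  isomorphism \<open>\<theta>\<close> from \<open>Y\<close> to \<open>A\<close>, which makes \<open>r\<close> the deflation of a conflation with cocone \<open>K\<close>.
\<close>

lemma deflation_of_retract:
  assumes a: "f \<in> arr C" "r \<in> arr C" "t \<in> arr C" "src C t = tgt C f" "tgt C t = src C f" "src C r = src C f"
    "t \<cdot> f = ident C (src C f)"
    and R: "realizes C w (r \<cdot> t) B W \<epsilon>"
  obtains K U k s \<pi> \<sigma> x where "biproduct C K U W k s \<pi> \<sigma>" "conflation C x r" "src C x = K"
proof -
  note D = realizesD[OF R]
  have wX: "tgt C w = tgt C f" using a D by simp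
  obtain U s q where X: "biproduct C (src C f) U (tgt C f) f s t q"
    using retract_complement[of f t] a by auto
  note XD = biproductD[OF X]
  have "(r \<cdot> t) \<cdot> s = zero_mor C (src C s) B" using a(1-6) XD(1-19) D(8) by simp
  then obtain s' where s': "s' \<in> arr C" "src C s' = U" "tgt C s' = W" "w \<cdot> s' = s"
    using factor_through_inflation[OF R, of s] XD a by auto
  have qs: "(q \<cdot> w) \<cdot> s' = ident C U" using s' XD(1-15,17) D wX by simp
  obtain K k \<pi> where "biproduct C (src C s') K (tgt C s') s' k (q \<cdot> w) \<pi>"
    using retract_complement[of s' "q \<cdot> w"] s' qs XD D wX by auto
  hence W: "biproduct C K U W k s' \<pi> (q \<cdot> w)" using s' biproduct_swap by simp
  note WD = biproductD[OF W]
  \<comment> \<open>\<open>\<omega>\<close> is the \<open>K\<close>-component of \<open>\<epsilon>\<close>; pushing it forward along \<open>k\<close> gives back \<open>\<epsilon>\<close>.\<close>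
  define \<omega> where "\<omega> = push C B \<pi> \<epsilon>"
  have \<omega>: "\<omega> \<in> carrier (Ext C B K)" using WD D by (simp add: \<omega>_def)
  interpret GW: group "Ext C B W" by (rule Ext_group) (use D in simp_all)
  have "\<epsilon> = push C B (k \<cdot> \<pi> \<boxplus> s' \<cdot> (q \<cdot> w)) \<epsilon>" unfolding WD(20) using D by simp
  also have "\<dots> = push C B (k \<cdot> \<pi>) \<epsilon> \<otimes>\<^bsub>Ext C B W\<^esub> push C B (s' \<cdot> (q \<cdot> w)) \<epsilon>"
    using push_plus'[of B "k \<cdot> \<pi>" "s' \<cdot> (q \<cdot> w)" \<epsilon>] WD(1-15) D by simp
  also have "push C B (k \<cdot> \<pi>) \<epsilon> = push C B k \<omega>"
    unfolding \<omega>_def using WD(1-15) D by (simp add: push_cmp)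
  also have "push C B (s' \<cdot> (q \<cdot> w)) \<epsilon> = push C B s' (push C B q (push C B w \<epsilon>))"
    using s'(1-3) XD(1-15) D wX by (simp add: push_cmp)
  also have "\<dots> = \<one>\<^bsub>Ext C B W\<^esub>" using push_inflation[OF R] s'(1-3) XD(1-15) D(1-7) wX by simp
  finally have \<epsilon>: "\<epsilon> = push C B k \<omega>" using WD D \<omega> by simp
  obtain x0 y0 where xy: "realizes C x0 y0 B K \<omega>" using D(1) WD(1) \<omega> by (rule ex_realization)
  note YD = realizesD[OF xy]
  obtain Z where Z: "zero_object C Z" "Z \<in> obj C" by (rule obtain_zero_object)
  obtain Q i j p p' where Q: "biproduct C (tgt C x0) U Q i j p p'"
    using ex_biproduct[OF tgt_in_obj[OF YD(4)] XD(2)] by blast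
  note QD = biproductD[OF Q]
  have Q': "biproduct C (tgt C x0) (tgt C (ident C U)) Q i j p p'" using Q XD(2) by simp
  let ?x = "mor_sum C \<pi> (q \<cdot> w) i j x0 (ident C U)"
  let ?y = "mor_sum C p p' (ident C B) (zero_mor C Z B) y0 (zero_mor C U Z)"
  have "realizes C ?x ?y B W (ext_sum C B W (ident C B) (zero_mor C B Z) k s' \<omega> \<one>\<^bsub>Ext C Z U\<^esub>)"
    by (rule rz_sum[OF xy realizes_ident(1)[OF Z(1) XD(2)] W Q' biproduct_zero_right[OF Z(1) D(1)]])
  moreover have "ext_sum C B W (ident C B) (zero_mor C B Z) k s' \<omega> \<one>\<^bsub>Ext C Z U\<^esub> = \<epsilon>"
    unfolding ext_sum_def \<epsilon> using WD(1-15) \<omega> D(1-3) Z XD(2) s'(1-3)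
    by (simp add: Emap_eq_push_pull)
  moreover have "?y = y0 \<cdot> p" using QD(1-15) YD Z XD(2) D(1) by (simp add: mor_sum_def)
  ultimately have xy': "realizes C ?x (y0 \<cdot> p) B W \<epsilon>" by simp
  have x: "?x \<cdot> s' = j" using QD(1-15) YD s'(1-3) WD(1-19) XD(1-15) by (simp add: mor_sum_def)
  obtain \<phi> where \<phi>: "iso_mor C \<phi>" "\<phi> \<in> arr C" "src C \<phi> = src C (y0 \<cdot> p)" "tgt C \<phi> = src C (r \<cdot> t)"
    "\<phi> \<cdot> ?x = w" "(r \<cdot> t) \<cdot> \<phi> = y0 \<cdot> p" "?x \<in> arr C" "tgt C ?x = src C (y0 \<cdot> p)" "src C ?x = W"
    using realizes_unique[OF xy' R] by (rule seq_relD)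
  have s\<phi>: "src C \<phi> = Q" and t\<phi>: "tgt C \<phi> = tgt C f" using \<phi>(3,4) QD(1-15) YD a by simp_all
  obtain \<psi> where \<psi>: "\<psi> \<in> arr C" "src C \<psi> = tgt C \<phi>" "tgt C \<psi> = src C \<phi>"
    "\<psi> \<cdot> \<phi> = ident C (src C \<phi>)" "\<phi> \<cdot> \<psi> = ident C (tgt C \<phi>)" "iso_mor C \<psi>"
    using \<phi>(1) by (rule iso_morE)
  have "(\<phi> \<cdot> ?x) \<cdot> s' = \<phi> \<cdot> (?x \<cdot> s')"
    by (rule assoc) (use \<phi>(2,3,7,8,9) s'(1-3) in simp_all)
  hence \<phi>j: "\<phi> \<cdot> j = s" unfolding \<phi>(5) s'(4) x by (rule sym)
  have "\<psi> \<cdot> s = (\<psi> \<cdot> \<phi>) \<cdot> j" unfolding \<phi>j[symmetric] using \<psi>(1-3) \<phi>(2) s\<phi> QD(1-15) by simp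
  hence \<psi>s: "\<psi> \<cdot> s = j" unfolding \<psi>(4) s\<phi> using QD(1-15) by simp
  \<comment> \<open>\<open>\<theta>\<close> and \<open>\<theta>'\<close> are the diagonal entries of \<open>\<phi>\<close> and \<open>\<psi>\<close> between \<open>Y\<close> and \<open>A\<close>. They are mutually
      inverse because \<open>\<phi>\<close> and \<open>\<psi>\<close> map the summand \<open>U\<close> identically onto \<open>U\<close>.\<close>
  define \<theta> where "\<theta> = t \<cdot> (\<phi> \<cdot> i)"
  define \<theta>' where "\<theta>' = p \<cdot> (\<psi> \<cdot> f)"
  have \<theta>: "\<theta> \<in> arr C" "src C \<theta> = tgt C x0" "tgt C \<theta> = src C f"
    "\<theta>' \<in> arr C" "src C \<theta>' = src C f" "tgt C \<theta>' = tgt C x0"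
    using a(1-6) \<phi>(2) \<psi>(1-3) s\<phi> t\<phi> QD(1-15) by (simp_all add: \<theta>_def \<theta>'_def)
  have 1: "\<theta> \<cdot> \<theta>' = ident C (src C f)"
  proof -
    have "ident C (src C f) = t \<cdot> ((\<phi> \<cdot> \<psi>) \<cdot> f)" unfolding \<psi>(5) using a t\<phi> by simp
    also have "\<dots> = t \<cdot> (\<phi> \<cdot> ((i \<cdot> p \<boxplus> j \<cdot> p') \<cdot> (\<psi> \<cdot> f)))"
      unfolding QD(20) using a(1-6) \<phi>(2) s\<phi> t\<phi> \<psi>(1-3) by simp
    also have "\<dots> = \<theta> \<cdot> \<theta>' \<boxplus> t \<cdot> ((\<phi> \<cdot> j) \<cdot> (p' \<cdot> (\<psi> \<cdot> f)))"
      unfolding \<theta>_def \<theta>'_def using a(1-6) \<phi>(2) s\<phi> t\<phi> \<psi>(1-3) QD(1-15) by simp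
    also have "t \<cdot> ((\<phi> \<cdot> j) \<cdot> (p' \<cdot> (\<psi> \<cdot> f))) = (t \<cdot> s) \<cdot> (p' \<cdot> (\<psi> \<cdot> f))"
      unfolding \<phi>j using a(1-6) s\<phi> t\<phi> \<psi>(1-3) QD(1-15) XD(1-15) by simp
    also have "\<dots> = zero_mor C (src C f) (src C f)"
      unfolding XD(19) using a(1-6) s\<phi> t\<phi> \<psi>(1-3) QD(1-15) XD(1-15) by simp
    finally show ?thesis using \<theta> a by simp
  qed
  have 2: "\<theta>' \<cdot> \<theta> = ident C (tgt C x0)"
  proof -
    have "ident C (tgt C x0) = p \<cdot> ((\<psi> \<cdot> \<phi>) \<cdot> i)" unfolding \<psi>(4) using s\<phi> QD by simp
    also have "\<dots> = p \<cdot> (\<psi> \<cdot> ((f \<cdot> t \<boxplus> s \<cdot> q) \<cdot> (\<phi> \<cdot> i)))"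
      unfolding XD(20) using \<phi>(2) s\<phi> t\<phi> \<psi>(1-3) QD(1-15) by simp
    also have "\<dots> = \<theta>' \<cdot> \<theta> \<boxplus> p \<cdot> ((\<psi> \<cdot> s) \<cdot> (q \<cdot> (\<phi> \<cdot> i)))"
      unfolding \<theta>_def \<theta>'_def using a(1-6) \<phi>(2) s\<phi> t\<phi> \<psi>(1-3) QD(1-15) XD(1-15) by simp
    also have "p \<cdot> ((\<psi> \<cdot> s) \<cdot> (q \<cdot> (\<phi> \<cdot> i))) = (p \<cdot> j) \<cdot> (q \<cdot> (\<phi> \<cdot> i))"
      unfolding \<psi>s using \<phi>(2) s\<phi> t\<phi> QD(1-15) XD(1-15) by simp
    also have "\<dots> = zero_mor C (tgt C x0) (tgt C x0)"
      unfolding QD(19) using \<phi>(2) s\<phi> t\<phi> QD(1-15) XD(1-15) by simp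
    finally show ?thesis using \<theta> YD by simp
  qed
  have "r \<cdot> \<theta> = ((r \<cdot> t) \<cdot> \<phi>) \<cdot> i" unfolding \<theta>_def using a(1-6) \<phi>(2) s\<phi> t\<phi> QD(1-15) by simp
  also have "\<dots> = y0" unfolding \<phi>(6) using QD(1-16) YD by simp
  finally have "r \<cdot> \<theta> = y0" .
  moreover have "iso_mor C \<theta>" by (rule iso_morI[of _ \<theta>']) (use \<theta> 1 2 in simp_all)
  ultimately have "realizes C (\<theta> \<cdot> x0) r B K \<omega>"
    using xy \<theta> a YD by (intro realizes_iso) simp_all
  thus thesis using that[OF W realizes_conflation] realizesD(6) by blast
qed

end

section \<open>From cotorsion pairs to weak factorization systems\<close>

context extriangulated_category
begin

text \<open>
  A lift \<open>t0\<close> of \<open>b\<close> along \<open>g\<close> exists since \<open>b\<^sup>*\<epsilon>\<close> becomes zero after pulling back along \<open>f\<close>, hence comes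
  from \<open>E(D,V) = 0\<close>. The defect \<open>t0 \<cdot> f - a\<close> factors through the cocone \<open>V\<close> of \<open>g\<close>, and the resulting
  morphism \<open>s\<close> to \<open>V\<close> extends along \<open>f\<close>, again since \<open>E(D,V) = 0\<close>; subtracting the extension
  corrects \<open>t0\<close>.
\<close>

lemma lifts_inflation_deflation:
  assumes F: "realizes C f y D A \<delta>" and G: "realizes C v g Y V \<epsilon>"
    and orth: "carrier (Ext C D V) = {\<one>\<^bsub>Ext C D V\<^esub>}"
  shows "lifts C f g"
  unfolding lifts_def
proof (intro ballI impI)
  fix a b assume "a \<in> mor C (src C f) (src C g)" "b \<in> mor C (tgt C f) (tgt C g)" and sq: "g \<cdot> a = b \<cdot> f"
  note FD = realizesD[OF F] and GD = realizesD[OF G]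
  have a: "a \<in> arr C" "src C a = A" "tgt C a = src C g"
    and b: "b \<in> arr C" "src C b = tgt C f" "tgt C b = Y"
    using \<open>a \<in> _\<close> \<open>b \<in> _\<close> FD GD by (simp_all add: mor_iff)
  have "pull C V f (pull C V b \<epsilon>) = pull C V (g \<cdot> a) \<epsilon>"
    unfolding sq by (rule pull_cmp[symmetric]) (use b FD GD in simp_all)
  also have "\<dots> = pull C V a (pull C V g \<epsilon>)" by (rule pull_cmp) (use a GD in simp_all)
  also have "\<dots> = \<one>\<^bsub>Ext C A V\<^esub>" unfolding pull_deflation[OF G] using a GD by simp
  finally obtain \<theta> where \<theta>: "\<theta> \<in> carrier (Ext C D V)" "pull C V b \<epsilon> = pull C V y \<theta>"
    by (rule ext_factor_through_deflation[OF F GD(2), rotated]) (use b GD in simp_all)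
  have "pull C V b \<epsilon> = \<one>\<^bsub>Ext C (src C b) V\<^esub>" using \<theta> orth FD GD b by simp
  then obtain t0 where t0: "t0 \<in> arr C" "src C t0 = tgt C f" "tgt C t0 = src C g" "g \<cdot> t0 = b"
    using lift_along_deflation[OF G b(1,3)] b(2) by metis
  let ?n = "t0 \<cdot> f \<boxplus> neg C a"
  have n: "?n \<in> arr C" "src C ?n = A" "tgt C ?n = src C g" using t0 a FD by simp_all
  have "(g \<cdot> t0) \<cdot> f = g \<cdot> a" unfolding t0(4) sq ..
  hence "g \<cdot> ?n = zero_mor C A Y" using t0(1-3) a FD GD by simp
  then obtain s where s: "s \<in> arr C" "src C s = A" "tgt C s = V" "v \<cdot> s = ?n"
    using factor_through_inflation[OF G n(1,3)] n(2) by metis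
  have "push C D s \<delta> = \<one>\<^bsub>Ext C D (tgt C s)\<^esub>"
    using orth push_closed[of D s V \<delta>] s FD by auto
  then obtain s' where s': "s' \<in> arr C" "src C s' = tgt C f" "tgt C s' = V" "s' \<cdot> f = s"
    using extend_along_inflation[OF F s(1,2)] s(3) by metis
  let ?t = "t0 \<boxplus> neg C (v \<cdot> s')"
  have "?t \<cdot> f = t0 \<cdot> f \<boxplus> neg C (v \<cdot> (s' \<cdot> f))"
    using t0(1-3) s'(1-3) FD GD by simp
  also have "\<dots> = t0 \<cdot> f \<boxplus> neg C ?n" unfolding s'(4) s(4) ..
  also have "\<dots> = a"
    using minus_eq_iff[of "t0 \<cdot> f" ?n a] minus_plus_cancel(2)[of "t0 \<cdot> f" a] t0(1-3) a FD n by simp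
  finally have 1: "?t \<cdot> f = a" .
  have "g \<cdot> ?t = b \<boxplus> neg C ((g \<cdot> v) \<cdot> s')" using t0 s' GD(1-8) FD by simp
  also have "\<dots> = b \<boxplus> neg C (zero_mor C (tgt C f) Y)"
    unfolding conflation_cmp_zero[OF G] using s' GD by simp
  also have "\<dots> = b" using minus_eq_iff[of b "zero_mor C (tgt C f) Y" b] b GD FD by simp
  finally have 2: "g \<cdot> ?t = b" .
  show "\<exists>t\<in>mor C (tgt C f) (src C g). t \<cdot> f = a \<and> g \<cdot> t = b"
    using 1 2 t0(1-3) s'(1-3) GD by (intro bexI[of _ ?t]) (simp_all add: mor_iff)
qed

lemma cotorsion_pairD:
  assumes "(U, V) \<in> cotorsion_pairs C"
  shows "U \<subseteq> obj C" "V \<subseteq> obj C"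
    "\<And>A B. \<lbrakk>A \<in> U; B \<in> obj C; isomorphic_obj C A B\<rbrakk> \<Longrightarrow> B \<in> U"
    "\<And>A B. \<lbrakk>A \<in> V; B \<in> obj C; isomorphic_obj C A B\<rbrakk> \<Longrightarrow> B \<in> V"
    "\<And>P A B i j p q. \<lbrakk>P \<in> U; biproduct C A B P i j p q\<rbrakk> \<Longrightarrow> A \<in> U"
    "\<And>P A B i j p q. \<lbrakk>P \<in> V; biproduct C A B P i j p q\<rbrakk> \<Longrightarrow> A \<in> V"
    "\<And>A B. \<lbrakk>A \<in> U; B \<in> V\<rbrakk> \<Longrightarrow> carrier (Ext C A B) = {\<one>\<^bsub>Ext C A B\<^esub>}"
    "\<And>X. X \<in> obj C \<Longrightarrow> \<exists>x y. conflation C x y \<and> src C x \<in> V \<and> tgt C x \<in> U \<and> tgt C y = X"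
    "\<And>X. X \<in> obj C \<Longrightarrow> \<exists>x y. conflation C x y \<and> src C x = X \<and> tgt C x \<in> V \<and> tgt C y \<in> U"
proof -
  have c: "additive_subcategory C U" "iso_closed C U" "summand_closed C U"
    "additive_subcategory C V" "iso_closed C V" "summand_closed C V"
    and e: "\<forall>A\<in>U. \<forall>B\<in>V. carrier (Ext C A B) = {\<one>\<^bsub>Ext C A B\<^esub>}"
    and r: "\<forall>X\<in>obj C. (\<exists>x y. conflation C x y \<and> src C x \<in> V \<and> tgt C x \<in> U \<and> tgt C y = X)"
      "\<forall>X\<in>obj C. (\<exists>x y. conflation C x y \<and> src C x = X \<and> tgt C x \<in> V \<and> tgt C y \<in> U)"
    using assms by (simp_all add: cotorsion_pairs_def)
  have u: "\<forall>A\<in>U. \<forall>B\<in>obj C. isomorphic_obj C A B \<longrightarrow> B \<in> U"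
      "\<forall>P\<in>U. \<forall>A B i j p q. biproduct C A B P i j p q \<longrightarrow> A \<in> U" "U \<subseteq> obj C"
    and v: "\<forall>A\<in>V. \<forall>B\<in>obj C. isomorphic_obj C A B \<longrightarrow> B \<in> V"
      "\<forall>P\<in>V. \<forall>A B i j p q. biproduct C A B P i j p q \<longrightarrow> A \<in> V" "V \<subseteq> obj C"
    using c unfolding additive_subcategory_def iso_closed_def summand_closed_def by satx+
  show "U \<subseteq> obj C" "V \<subseteq> obj C" by (fact u v)+
  show "B \<in> U" if "A \<in> U" "B \<in> obj C" "isomorphic_obj C A B" for A B using u(1) that by blast
  show "B \<in> V" if "A \<in> V" "B \<in> obj C" "isomorphic_obj C A B" for A B using v(1) that by blast
  show "A \<in> U" if "P \<in> U" "biproduct C A B P i j p q" for P A B i j p q using u(2) that by blast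
  show "A \<in> V" if "P \<in> V" "biproduct C A B P i j p q" for P A B i j p q using v(2) that by blast
  show "carrier (Ext C A B) = {\<one>\<^bsub>Ext C A B\<^esub>}" if "A \<in> U" "B \<in> V" for A B using e that by blast
  show "\<exists>x y. conflation C x y \<and> src C x \<in> V \<and> tgt C x \<in> U \<and> tgt C y = X" if "X \<in> obj C" for X
    using r(1) that by blast
  show "\<exists>x y. conflation C x y \<and> src C x = X \<and> tgt C x \<in> V \<and> tgt C y \<in> U" if "X \<in> obj C" for X
    using r(2) that by blast
qed

lemma additive_subcategory_opposite [simp]:
  "additive_subcategory (opposite C) U \<longleftrightarrow> additive_subcategory C U"
proof -
  have "(\<exists>i j p q. biproduct C A B P p q i j) \<longleftrightarrow> (\<exists>i j p q. biproduct C A B P i j p q)" for A B P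
    by blast
  thus ?thesis by (simp add: additive_subcategory_def)
qed

lemma summand_closed_opposite [simp]: "summand_closed (opposite C) U \<longleftrightarrow> summand_closed C U"
proof -
  have "(\<forall>i j p q. biproduct C A B P p q i j \<longrightarrow> A \<in> U) \<longleftrightarrow>
      (\<forall>i j p q. biproduct C A B P i j p q \<longrightarrow> A \<in> U)" for A B P by blast
  thus ?thesis by (simp add: summand_closed_def)
qed

lemma cotorsion_pairs_opposite:
  assumes "(U, V) \<in> cotorsion_pairs C"
  shows "(V, U) \<in> cotorsion_pairs (opposite C)"
proof -
  have 1: "additive_subcategory C U" "iso_closed C U" "summand_closed C U"
    "additive_subcategory C V" "iso_closed C V" "summand_closed C V"
    using assms by (simp_all add: cotorsion_pairs_def)
  have "iso_closed (opposite C) U" "iso_closed (opposite C) V" using 1 by (simp_all add: iso_closed_def)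
  moreover have "\<exists>x y. conflation C y x \<and> tgt C x \<in> U \<and> src C x \<in> V \<and> src C y = X" if "X \<in> obj C" for X
    using cotorsion_pairD(9)[OF assms that] conflationE by metis
  moreover have "\<exists>x y. conflation C y x \<and> tgt C x = X \<and> src C x \<in> U \<and> tgt C x \<in> obj C \<and> src C y \<in> V" if "X \<in> obj C" for X
    using cotorsion_pairD(8)[OF assms that] that conflationE by metis
  ultimately show ?thesis using 1 cotorsion_pairD(7)[OF assms] unfolding cotorsion_pairs_def by simp blast
qed

text \<open>
  The conflation \<open>V' \<rightarrow> U' \<rightarrow> D\<close> splits, so that \<open>D\<close> is a direct summand of \<open>U'\<close>.
\<close>

lemma left_perpendicular_in_cotorsion_class:
  assumes UV: "(U, V) \<in> cotorsion_pairs C" and "D \<in> obj C"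
    and "\<And>B. B \<in> V \<Longrightarrow> carrier (Ext C D B) = {\<one>\<^bsub>Ext C D B\<^esub>}"
  shows "D \<in> U"
proof -
  obtain x y where xy: "conflation C x y" "src C x \<in> V" "tgt C x \<in> U" "tgt C y = D"
    using cotorsion_pairD(8)[OF UV assms(2)] by blast
  obtain \<delta> where r: "realizes C x y D (src C x) \<delta>" using xy(1) by (rule conflationE) (simp add: xy(4))
  have "\<delta> = \<one>\<^bsub>Ext C D (src C x)\<^esub>" using realizesD(3)[OF r] assms(3)[OF xy(2)] by simp
  then obtain j p where "biproduct C (src C x) D (tgt C x) x j p y" using r split_conflation by metis
  thus ?thesis using cotorsion_pairD(5)[OF UV xy(3)] biproduct_swap by blast
qed

text \<open>
  The objects \<open>X\<close> with \<open>E(X,V) = 0\<close> are closed under extensions by exactness.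
\<close>

lemma cotorsion_class_extension_closed:
  assumes UV: "(U, V) \<in> cotorsion_pairs C"
    and xy: "conflation C x y" "src C x \<in> U" "tgt C y \<in> U"
  shows "tgt C x \<in> U"
proof -
  obtain \<delta> where r: "realizes C x y (tgt C y) (src C x) \<delta>" using xy(1) by (rule conflationE)
  note D = realizesD[OF r]
  show ?thesis
  proof (rule left_perpendicular_in_cotorsion_class[OF UV])
    show "tgt C x \<in> obj C" using D by simp
    fix B assume B: "B \<in> V"
    hence Bo: "B \<in> obj C" using cotorsion_pairD(2)[OF UV] by blast
    have "\<theta> = \<one>\<^bsub>Ext C (tgt C x) B\<^esub>" if \<theta>: "\<theta> \<in> carrier (Ext C (tgt C x) B)" for \<theta>
    proof -
      have "pull C B x \<theta> \<in> carrier (Ext C (src C x) B)" using \<theta> D Bo by simp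
      hence "pull C B x \<theta> = \<one>\<^bsub>Ext C (src C x) B\<^esub>" using cotorsion_pairD(7)[OF UV xy(2) B] by simp
      then obtain \<theta>' where "\<theta>' \<in> carrier (Ext C (tgt C y) B)" "\<theta> = pull C B y \<theta>'"
        by (rule ext_factor_through_deflation[OF r Bo \<theta>])
      thus ?thesis using cotorsion_pairD(7)[OF UV xy(3) B] D Bo by simp
    qed
    thus "carrier (Ext C (tgt C x) B) = {\<one>\<^bsub>Ext C (tgt C x) B\<^esub>}"
      using Ext_one_closed[of "tgt C x" B] D Bo by fastforce
  qed
qed

lemma InflI: "conflation C f y \<Longrightarrow> tgt C y \<in> U \<Longrightarrow> f \<in> Infl C U"
  using conflationE[of f y] by (auto simp: Infl_def inflation_def is_Cone_def)

lemma InflE: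
  assumes "f \<in> Infl C U"
  obtains y \<delta> where "realizes C f y (tgt C y) (src C f) \<delta>" "tgt C y \<in> U"
  using assms by (auto simp: Infl_def is_Cone_def conflation_def)

lemma DeflI: "conflation C x f \<Longrightarrow> src C x \<in> V \<Longrightarrow> f \<in> Defl C V"
  using conflationE[of x f] by (auto simp: Defl_def deflation_def is_CoCone_def)

lemma DeflE:
  assumes "f \<in> Defl C V"
  obtains x \<epsilon> where "realizes C x f (tgt C f) (src C x) \<epsilon>" "src C x \<in> V"
  using assms by (auto simp: Defl_def is_CoCone_def conflation_def)

text \<open>
  With \<open>V' \<rightarrow> U' \<rightarrow> B\<close> and \<open>W \<rightarrow> V'' \<rightarrow> U''\<close> from the cotorsion pair, where \<open>W\<close> is the cocone of
  \<open>(p, h) : U' \<oplus> A \<rightarrow> B\<close>, the factorization is \<open>A \<rightarrow> U' \<oplus> A \<rightarrow> M \<rightarrow> B\<close> with \<open>M\<close> the pushout of \<open>U' \<oplus> A\<close>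
  and \<open>V''\<close> under \<open>W\<close>.
\<close>

lemma cotorsion_factorization:
  assumes UV: "(U, V) \<in> cotorsion_pairs C" and h: "h \<in> arr C"
  shows "\<exists>f \<in> Infl C U. \<exists>g \<in> Defl C V. tgt C f = src C g \<and> h = g \<cdot> f"
proof -
  let ?B = "tgt C h"
  have B: "?B \<in> obj C" using h by simp
  obtain v p where vp: "conflation C v p" "tgt C v \<in> U" "tgt C p = ?B"
    using cotorsion_pairD(8)[OF UV B] by blast
  obtain \<delta> where vp': "realizes C v p ?B (src C v) \<delta>" using vp(1) by (rule conflationE) (simp add: vp(3))
  obtain w e P i j q q' \<epsilon> where e: "realizes C w e ?B (src C w) \<epsilon>"
    "biproduct C (src C p) (src C h) P i j q q'" "src C e = P" "e \<cdot> j = h"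
    by (rule deflation_row[OF vp' h refl])
  note PD = biproductD[OF e(2)] and eD = realizesD[OF e(1)]
  have pU: "src C p \<in> U" using vp(2) realizesD(7)[OF vp'] by simp
  obtain x2 y2 where xy2: "conflation C x2 y2" "src C x2 = src C w" "tgt C x2 \<in> V" "tgt C y2 \<in> U"
    using cotorsion_pairD(9)[OF UV eD(2)] by blast
  obtain \<delta>2 where xy2': "realizes C x2 y2 (tgt C y2) (src C w) \<delta>2"
    using xy2(1) by (rule conflationE) (simp add: xy2(2))
  obtain b u y \<delta>' w' z where M: "iso_mor C b" "b \<in> arr C" "src C b = tgt C w" "tgt C b = src C u"
    "realizes C u y (tgt C y2) (src C u) \<delta>'" "conflation C w' z" "isomorphic_obj C (tgt C x2) (src C w')"
    "z \<cdot> (u \<cdot> b) = e" "tgt C u = src C z" "tgt C z = ?B"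
    by (rule pushout_of_conflations[OF e(1) xy2'])
  note uD = realizesD[OF M(5)]
  have w': "w' \<in> arr C" "z \<in> arr C" using conflationE[OF M(6)] by metis+
  have "src C w' \<in> V" by (rule cotorsion_pairD(4)[OF UV xy2(3) _ M(7)]) (use w' in simp)
  hence z: "z \<in> Defl C V" using M(6) by (intro DeflI)
  obtain b' where b': "b' \<in> arr C" "src C b' = tgt C b" "tgt C b' = src C b"
    "b' \<cdot> b = ident C (src C b)" using M(1) by (rule iso_morE)
  have bP: "src C b = P" using M(3) e(3) eD by simp
  have "realizes C (b \<cdot> j) (q \<cdot> b') (src C p) (src C h) \<one>\<^bsub>Ext C (src C p) (src C h)\<^esub>"
    by (rule realizes_iso[OF rz_zero[OF biproduct_swap[OF e(2)]] M(1)])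
      (use M(2) b' bP PD(1-15) in simp_all)
  moreover have "tgt C (b \<cdot> j) = src C u" using M(2,4) bP PD(1-15) by simp
  ultimately obtain k d d' where k: "conflation C (u \<cdot> (b \<cdot> j)) k" "conflation C d d'" "tgt C k = tgt C d"
    "src C d = src C p" "tgt C d' = tgt C y2"
    using inflation_cmp[of "b \<cdot> j" _ _ _ _ u y "tgt C y2" \<delta>'] M(5) by metis
  have "tgt C d \<in> U" by (rule cotorsion_class_extension_closed[OF UV k(2)]) (use k pU xy2(4) in simp_all)
  hence f: "u \<cdot> (b \<cdot> j) \<in> Infl C U" using k by (intro InflI[OF k(1)]) simp
  have "z \<cdot> (u \<cdot> (b \<cdot> j)) = (z \<cdot> (u \<cdot> b)) \<cdot> j" using w' M(2,4,9) uD bP PD(1-15) by simp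
  hence "z \<cdot> (u \<cdot> (b \<cdot> j)) = h" unfolding M(8) e(4) .
  moreover have "tgt C (u \<cdot> (b \<cdot> j)) = src C z" using M(2,4,9) uD bP PD(1-15) by simp
  ultimately show ?thesis using f z by metis
qed

lemma is_Cone_from_zero:
  assumes "zero_object C Z" "D \<in> obj C"
  shows "is_Cone C (zero_mor C Z D) D" "inflation C (zero_mor C Z D)"
  using realizes_ident(2)[OF assms] realizes_conflation assms
  by (auto simp: is_Cone_def inflation_def intro!: exI[of _ "ident C D"])

text \<open>
  \<open>D\<close> is a cone of \<open>0 \<rightarrow> D\<close>, and every other cone is isomorphic to it.
\<close>

lemma zero_mor_in_Infl_iff:
  assumes "zero_object C Z" "D \<in> obj C" and iso: "\<And>A B. \<lbrakk>A \<in> U; B \<in> obj C; isomorphic_obj C A B\<rbrakk> \<Longrightarrow> B \<in> U"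
  shows "zero_mor C Z D \<in> Infl C U \<longleftrightarrow> D \<in> U"
proof
  assume "zero_mor C Z D \<in> Infl C U"
  then obtain D' where "is_Cone C (zero_mor C Z D) D'" "D' \<in> U" by (auto simp: Infl_def)
  thus "D \<in> U" using is_Cone_isomorphic[OF _ is_Cone_from_zero(1)[OF assms(1,2)]] iso assms(2) by blast
next
  assume "D \<in> U"
  thus "zero_mor C Z D \<in> Infl C U"
    using is_Cone_from_zero[OF assms(1,2)] zero_object_obj[OF assms(1)] assms(2) by (auto simp: Infl_def)
qed

lemma is_Cone_obj: "is_Cone C f D \<Longrightarrow> D \<in> obj C"
  by (auto simp: is_Cone_def conflation_def realizes_def)

lemma Infl_admissible:
  assumes "f \<in> arr C" "\<And>A B. \<lbrakk>A \<in> U; B \<in> obj C; isomorphic_obj C A B\<rbrakk> \<Longrightarrow> B \<in> U"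
  shows "f \<in> Infl C U \<longleftrightarrow>
    inflation C f \<and> (\<exists>Z D. zero_object C Z \<and> is_Cone C f D \<and> zero_mor C Z D \<in> Infl C U)"
proof -
  obtain Z where Z: "zero_object C Z" by (rule obtain_zero_object)
  have z: "zero_mor C Z D \<in> Infl C U \<longleftrightarrow> D \<in> U" if "zero_object C Z" "is_Cone C f D" for Z D
    using zero_mor_in_Infl_iff[OF that(1) is_Cone_obj[OF that(2)] assms(2)] .
  show ?thesis
  proof
    assume "f \<in> Infl C U"
    then obtain D where D: "inflation C f" "is_Cone C f D" "D \<in> U" by (auto simp: Infl_def)
    thus "inflation C f \<and> (\<exists>Z D. zero_object C Z \<and> is_Cone C f D \<and> zero_mor C Z D \<in> Infl C U)"
      using z[OF Z D(2)] Z by blast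
  next
    assume a: "inflation C f \<and> (\<exists>Z D. zero_object C Z \<and> is_Cone C f D \<and> zero_mor C Z D \<in> Infl C U)"
    then obtain Z D where "zero_object C Z" "is_Cone C f D" "zero_mor C Z D \<in> Infl C U" by blast
    thus "f \<in> Infl C U" using z[of Z D] a assms(1) unfolding Infl_def by blast
  qed
qed

lemma Cone_class_Infl:
  assumes "(U, V) \<in> cotorsion_pairs C"
  shows "Cone_class C (Infl C U) = U"
proof
  show "Cone_class C (Infl C U) \<subseteq> U"
  proof
    fix X assume "X \<in> Cone_class C (Infl C U)"
    then obtain f D D' where "X \<in> obj C" "is_Cone C f D" "isomorphic_obj C X D" "is_Cone C f D'" "D' \<in> U"
      by (auto simp: Cone_class_def Infl_def)
    thus "X \<in> U" using cotorsion_pairD(3)[OF assms] is_Cone_isomorphic isomorphic_trans isomorphic_sym by metis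
  qed
  show "U \<subseteq> Cone_class C (Infl C U)"
  proof
    fix X assume X: "X \<in> U"
    hence o: "X \<in> obj C" using cotorsion_pairD(1)[OF assms] by blast
    obtain Z where Z: "zero_object C Z" by (rule obtain_zero_object)
    have "zero_mor C Z X \<in> Infl C U"
      using zero_mor_in_Infl_iff[OF Z o, of U] cotorsion_pairD(3)[OF assms] X by blast
    thus "X \<in> Cone_class C (Infl C U)"
      using is_Cone_from_zero(1)[OF Z o] isomorphic_refl[OF o] o unfolding Cone_class_def by blast
  qed
qed

end

context wic_extriangulated_category
begin

text \<open>
  The retract argument: if \<open>r = g \<cdot> f\<close> with \<open>f \<in> Infl U\<close> and \<open>g \<in> Defl V\<close>, a lift of the identity
  against \<open>f\<close> gives \<open>t\<close> with \<open>t \<cdot> f = 1\<close> and \<open>r \<cdot> t = g\<close>, so that \<open>r\<close> is a retract of \<open>g\<close>.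
\<close>

lemma right_lift_Infl:
  assumes UV: "(U, V) \<in> cotorsion_pairs C"
  shows "right_lift C (Infl C U) = Defl C V"
proof
  show "right_lift C (Infl C U) \<subseteq> Defl C V"
  proof
    fix r assume "r \<in> right_lift C (Infl C U)"
    hence r: "r \<in> arr C" and lift: "\<And>l. l \<in> Infl C U \<Longrightarrow> lifts C l r" by (auto simp: right_lift_def)
    obtain f g where fg: "f \<in> Infl C U" "g \<in> Defl C V" "tgt C f = src C g" "r = g \<cdot> f"
      using cotorsion_factorization[OF UV r] by blast
    have a: "f \<in> arr C" "g \<in> arr C" using fg by (simp_all add: Infl_def Defl_def)
    have s: "src C r = src C f" "tgt C r = tgt C g" using fg a by simp_all
    have "ident C (src C f) \<in> mor C (src C f) (src C r)" "g \<in> mor C (tgt C f) (tgt C r)"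
      "r \<cdot> ident C (src C f) = g \<cdot> f"
      using r a s fg(3,4) by (simp_all add: mor_iff)
    then obtain t where "t \<in> mor C (tgt C f) (src C r)" "t \<cdot> f = ident C (src C f)" "r \<cdot> t = g"
      using lift[OF fg(1)] unfolding lifts_def by blast
    hence t: "t \<in> arr C" "src C t = tgt C f" "tgt C t = src C f" "t \<cdot> f = ident C (src C f)" "r \<cdot> t = g"
      using s by (simp_all add: mor_iff)
    obtain w \<epsilon> where w: "realizes C w g (tgt C g) (src C w) \<epsilon>" "src C w \<in> V" using fg(2) by (rule DeflE)
    obtain K U' k s' \<pi> \<sigma> x where K: "biproduct C K U' (src C w) k s' \<pi> \<sigma>" "conflation C x r" "src C x = K"
      by (rule deflation_of_retract[OF a(1) r t(1-3) s(1) t(4) w(1)[folded t(5)]])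
    have "K \<in> V" using cotorsion_pairD(6)[OF UV w(2) K(1)] .
    thus "r \<in> Defl C V" using DeflI[OF K(2)] K(3) by simp
  qed
  show "Defl C V \<subseteq> right_lift C (Infl C U)"
  proof
    fix g assume g: "g \<in> Defl C V"
    then obtain x \<epsilon> where x: "realizes C x g (tgt C g) (src C x) \<epsilon>" "src C x \<in> V" by (rule DeflE)
    have "lifts C f g" if "f \<in> Infl C U" for f
      using that by (rule InflE) (rule lifts_inflation_deflation[OF _ x(1) cotorsion_pairD(7)[OF UV _ x(2)]])
    thus "g \<in> right_lift C (Infl C U)" using g by (simp add: right_lift_def Defl_def)
  qed
qed

lemma cotorsion_pair_admissible_wfs:
  assumes UV: "(U, V) \<in> cotorsion_pairs C"
  shows "(Infl C U, Defl C V) \<in> admissible_wfs C"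
proof -
  note op = cotorsion_pairs_opposite[OF UV]
  have "left_lift C (Defl C V) = Infl C U"
    using wic_extriangulated_category.right_lift_Infl[OF opposite_wic op] by simp
  moreover have "f \<in> Defl C V \<longleftrightarrow>
      deflation C f \<and> (\<exists>Z A. zero_object C Z \<and> is_CoCone C f A \<and> zero_mor C A Z \<in> Defl C V)"
    if "f \<in> arr C" for f
    using extriangulated_category.Infl_admissible[OF opposite_extriangulated, of f V]
      that cotorsion_pairD(4)[OF UV] by simp
  ultimately show ?thesis
    using right_lift_Infl[OF UV] cotorsion_factorization[OF UV] Infl_admissible[OF _ cotorsion_pairD(3)[OF UV]]
    unfolding admissible_wfs_def weak_factorization_system_def
    by (auto simp: Infl_def[of C U] Defl_def[of C V])
qed

end

section \<open>From admissible weak factorization systems to cotorsion pairs\<close>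

text \<open>
  Equivalently, \<open>0 \<rightarrow> X\<close> has the left lifting property against \<open>R\<close>. This form does not refer to a
  choice of zero object and shows at once that the class is closed under retracts and finite
  direct sums.
\<close>

definition relatively_projective :: "('o, 'm, 'z) precategory_scheme \<Rightarrow> 'm set \<Rightarrow> 'o \<Rightarrow> bool" where
  "relatively_projective C R X \<longleftrightarrow> X \<in> obj C \<and>
     (\<forall>r \<in> R. \<forall>g \<in> mor C X (tgt C r). \<exists>t \<in> mor C X (src C r). r \<cdot> t = g)"
  for C (structure)

lemma (in category) relatively_projective_retract:
  assumes "relatively_projective C R P" "R \<subseteq> arr C" "i \<in> arr C" "p \<in> arr C" "src C i = A" "tgt C i = P"
    "src C p = P" "tgt C p = A" "p \<cdot> i = ident C A"
  shows "relatively_projective C R A"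
  unfolding relatively_projective_def
proof (intro conjI ballI)
  show "A \<in> obj C" using assms by auto
  fix r g assume "r \<in> R" "g \<in> mor C A (tgt C r)"
  hence r: "r \<in> R" "r \<in> arr C" and g: "g \<in> arr C" "src C g = A" "tgt C g = tgt C r"
    using assms(2) by (auto simp: mor_iff)
  have "g \<cdot> p \<in> mor C P (tgt C r)" using g assms by (simp add: mor_iff)
  then obtain t where "t \<in> mor C P (src C r)" and t: "r \<cdot> t = g \<cdot> p"
    using assms(1) r(1) unfolding relatively_projective_def by blast
  hence t': "t \<in> arr C" "src C t = P" "tgt C t = src C r" by (simp_all add: mor_iff)
  have "r \<cdot> (t \<cdot> i) = (g \<cdot> p) \<cdot> i" unfolding t[symmetric] using t' r(2) assms(3-8) by simp
  also have "\<dots> = g" using g assms(3-9) by simp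
  finally show "\<exists>t\<in>mor C A (src C r). r \<cdot> t = g"
    using t' assms(3-8) by (intro bexI[of _ "t \<cdot> i"]) (simp_all add: mor_iff)
qed

lemma (in category) relatively_projective_iso:
  assumes "relatively_projective C R A" "R \<subseteq> arr C" "isomorphic_obj C A B"
  shows "relatively_projective C R B"
proof -
  obtain f where f: "iso_mor C f" "f \<in> arr C" "src C f = A" "tgt C f = B"
    using assms(3) by (rule isomorphic_objE)
  from f(1) obtain g where "g \<in> arr C" "src C g = tgt C f" "tgt C g = src C f" "f \<cdot> g = ident C (tgt C f)"
    by (rule iso_morE)
  thus ?thesis using f by (intro relatively_projective_retract[OF assms(1,2), of g f]) simp_all
qed

context additive_category
begin

lemma relatively_projective_biproduct:
  assumes "relatively_projective C R A" "relatively_projective C R B" "R \<subseteq> arr C"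
    "biproduct C A B P i j p q"
  shows "relatively_projective C R P"
  unfolding relatively_projective_def
proof (intro conjI ballI)
  note D = biproductD[OF assms(4)]
  show "P \<in> obj C" by (rule D)
  fix r g assume "r \<in> R" "g \<in> mor C P (tgt C r)"
  hence r: "r \<in> R" "r \<in> arr C" and g: "g \<in> arr C" "src C g = P" "tgt C g = tgt C r"
    using assms(3) by (auto simp: mor_iff)
  have "g \<cdot> i \<in> mor C A (tgt C r)" "g \<cdot> j \<in> mor C B (tgt C r)" using g D(1-15) by (simp_all add: mor_iff)
  then obtain t u where tu: "t \<in> mor C A (src C r)" "r \<cdot> t = g \<cdot> i" "u \<in> mor C B (src C r)" "r \<cdot> u = g \<cdot> j"
    using assms(1,2) r(1) unfolding relatively_projective_def by meson
  hence m: "t \<in> arr C" "src C t = A" "tgt C t = src C r" "u \<in> arr C" "src C u = B" "tgt C u = src C r"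
    by (simp_all add: mor_iff)
  have "r \<cdot> (t \<cdot> p \<boxplus> u \<cdot> q) = (r \<cdot> t) \<cdot> p \<boxplus> (r \<cdot> u) \<cdot> q" using m r(2) D(1-15) by simp
  also have "\<dots> = g \<cdot> (i \<cdot> p \<boxplus> j \<cdot> q)" unfolding tu using g D(1-15) by simp
  also have "\<dots> = g" unfolding D(20) using g by simp
  finally show "\<exists>t\<in>mor C P (src C r). r \<cdot> t = g"
    using m D(1-15) by (intro bexI[of _ "t \<cdot> p \<boxplus> u \<cdot> q"]) (simp_all add: mor_iff)
qed

lemma zero_mor_in_left_lift_iff:
  assumes "zero_object C Z" "X \<in> obj C" "R \<subseteq> arr C"
  shows "zero_mor C Z X \<in> left_lift C R \<longleftrightarrow> relatively_projective C R X"
proof -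
  note Z = assms(1) zero_object_obj[OF assms(1)]
  have "lifts C (zero_mor C Z X) r \<longleftrightarrow> (\<forall>g \<in> mor C X (tgt C r). \<exists>t \<in> mor C X (src C r). r \<cdot> t = g)"
    if r: "r \<in> arr C" for r
  proof -
    have "f = t \<cdot> zero_mor C Z X" if "f \<in> mor C Z (src C r)" "t \<in> mor C X (src C r)" for f t
      by (rule from_zero_object[OF Z(1)]) (use that Z assms(2) r in \<open>simp_all add: mor_iff\<close>)
    moreover have "r \<cdot> f = g \<cdot> zero_mor C Z X" if "f \<in> mor C Z (src C r)" "g \<in> mor C X (tgt C r)" for f g
      by (rule from_zero_object[OF Z(1)]) (use that Z assms(2) r in \<open>simp_all add: mor_iff\<close>)
    moreover have "zero_mor C Z (src C r) \<in> mor C Z (src C r)" using Z r by (simp add: mor_iff)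
    ultimately show ?thesis using Z(2) assms(2) unfolding lifts_def by simp metis
  qed
  hence "\<forall>r \<in> R. lifts C (zero_mor C Z X) r \<longleftrightarrow>
      (\<forall>g \<in> mor C X (tgt C r). \<exists>t \<in> mor C X (src C r). r \<cdot> t = g)"
    using assms(3) by blast
  thus ?thesis using assms(2) Z(2) by (simp add: left_lift_def relatively_projective_def)
qed

end

context extriangulated_category
begin

lemma admissible_wfsD:
  assumes "(L, R) \<in> admissible_wfs C"
  shows "L \<subseteq> arr C" "R \<subseteq> arr C" "right_lift C L = R" "left_lift C R = L"
    "\<And>h. h \<in> arr C \<Longrightarrow> \<exists>f \<in> L. \<exists>g \<in> R. tgt C f = src C g \<and> h = g \<cdot> f"
    "\<And>f. f \<in> arr C \<Longrightarrow> f \<in> L \<longleftrightarrow> inflation C f \<and> (\<exists>Z D. zero_object C Z \<and> is_Cone C f D \<and> zero_mor C Z D \<in> L)"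
    "\<And>f. f \<in> arr C \<Longrightarrow> f \<in> R \<longleftrightarrow> deflation C f \<and> (\<exists>Z A. zero_object C Z \<and> is_CoCone C f A \<and> zero_mor C A Z \<in> R)"
  using assms unfolding admissible_wfs_def weak_factorization_system_def by blast+

lemma admissible_wfs_opposite:
  assumes "(L, R) \<in> admissible_wfs C"
  shows "(R, L) \<in> admissible_wfs (opposite C)"
proof -
  note W = admissible_wfsD[OF assms]
  have "\<exists>f\<in>R. \<exists>g\<in>L. src C f = tgt C g \<and> h = f \<cdot> g" if "h \<in> arr C" for h
    using W(5)[OF that] by metis
  thus ?thesis using W(1-4,6,7) unfolding admissible_wfs_def weak_factorization_system_def by simp
qed

text \<open>
  By admissibility \<open>X\<close> is a cone of a morphism in \<open>L\<close> precisely if \<open>0 \<rightarrow> X\<close> lies in \<open>L\<close>, which is the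
  left lifting class of \<open>R\<close>.
\<close>

lemma Cone_class_iff_relatively_projective:
  assumes LR: "(L, R) \<in> admissible_wfs C"
  shows "X \<in> Cone_class C L \<longleftrightarrow> relatively_projective C R X"
proof
  note W = admissible_wfsD[OF LR]
  assume "X \<in> Cone_class C L"
  then obtain f D where f: "X \<in> obj C" "f \<in> L" "is_Cone C f D" "isomorphic_obj C X D"
    by (auto simp: Cone_class_def)
  obtain Z D' where D': "zero_object C Z" "is_Cone C f D'" "zero_mor C Z D' \<in> L"
    using W(6)[of f] f(2) W(1) by blast
  have "relatively_projective C R D'"
    using zero_mor_in_left_lift_iff[OF D'(1) is_Cone_obj[OF D'(2)] W(2)] D'(3) W(4) by simp
  moreover have "isomorphic_obj C D' X"
    using is_Cone_isomorphic[OF D'(2) f(3)] isomorphic_sym[OF f(4)] isomorphic_trans by blast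
  ultimately show "relatively_projective C R X" using relatively_projective_iso[OF _ W(2)] by blast
next
  note W = admissible_wfsD[OF LR]
  assume p: "relatively_projective C R X"
  hence X: "X \<in> obj C" by (simp add: relatively_projective_def)
  obtain Z where Z: "zero_object C Z" by (rule obtain_zero_object)
  have "zero_mor C Z X \<in> L" using zero_mor_in_left_lift_iff[OF Z X W(2)] p W(4) by simp
  thus "X \<in> Cone_class C L"
    using is_Cone_from_zero(1)[OF Z X] isomorphic_refl[OF X] X by (auto simp: Cone_class_def)
qed

lemma Infl_Cone_class:
  assumes LR: "(L, R) \<in> admissible_wfs C"
  shows "Infl C (Cone_class C L) = L"
proof -
  note W = admissible_wfsD[OF LR]
  have "zero_mor C Z D \<in> L \<longleftrightarrow> D \<in> Cone_class C L" if "zero_object C Z" "is_Cone C f D" for Z D f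
    unfolding Cone_class_iff_relatively_projective[OF LR]
    using zero_mor_in_left_lift_iff[OF that(1) is_Cone_obj[OF that(2)] W(2)] W(4) by simp
  hence "f \<in> L \<longleftrightarrow> inflation C f \<and> (\<exists>D. is_Cone C f D \<and> D \<in> Cone_class C L)" if "f \<in> arr C" for f
    unfolding W(6)[OF that] using ex_zero_object by blast
  thus ?thesis using W(1) by (auto simp: Infl_def)
qed

lemma CoCone_class_opposite [simp]: "CoCone_class (opposite C) L = Cone_class C L"
  and Cone_class_opposite [simp]: "Cone_class (opposite C) L = CoCone_class C L"
  by (simp_all add: Cone_class_def CoCone_class_def)

lemma Defl_CoCone_class:
  assumes "(L, R) \<in> admissible_wfs C"
  shows "Defl C (CoCone_class C R) = R"
  using extriangulated_category.Infl_Cone_class[OF opposite_extriangulated admissible_wfs_opposite[OF assms]]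
  by simp

lemma CoCone_class_Defl:
  assumes "(U, V) \<in> cotorsion_pairs C"
  shows "CoCone_class C (Defl C V) = V"
  using extriangulated_category.Cone_class_Infl[OF opposite_extriangulated cotorsion_pairs_opposite[OF assms]]
  by simp

lemma Cone_class_subcategory:
  assumes LR: "(L, R) \<in> admissible_wfs C"
  shows "additive_subcategory C (Cone_class C L)" "iso_closed C (Cone_class C L)"
    "summand_closed C (Cone_class C L)"
proof -
  note W = admissible_wfsD[OF LR] and c = Cone_class_iff_relatively_projective[OF LR]
  obtain Z where Z: "zero_object C Z" "Z \<in> obj C" by (rule obtain_zero_object)
  have "relatively_projective C R Z"
    unfolding relatively_projective_def
  proof (intro conjI ballI)
    fix r g assume "r \<in> R" "g \<in> mor C Z (tgt C r)"
    hence r: "r \<in> arr C" and g: "g \<in> arr C" "src C g = Z" "tgt C g = tgt C r"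
      using W(2) by (auto simp: mor_iff)
    have "r \<cdot> zero_mor C Z (src C r) = g"
      by (rule from_zero_object[OF Z(1)]) (use r g Z in simp_all)
    thus "\<exists>t\<in>mor C Z (src C r). r \<cdot> t = g"
      using r Z by (intro bexI[of _ "zero_mor C Z (src C r)"]) (simp_all add: mor_iff)
  qed (rule Z)
  moreover have "\<exists>P i j p q. relatively_projective C R P \<and> biproduct C A B P i j p q"
    if "relatively_projective C R A" "relatively_projective C R B" for A B
    using that ex_biproduct[of A B] relatively_projective_biproduct[OF that W(2)]
    unfolding relatively_projective_def[of C R A] relatively_projective_def[of C R B] by blast
  ultimately show "additive_subcategory C (Cone_class C L)"
    using Z(1) unfolding additive_subcategory_def Bex_def Ball_def c
    by (auto simp: Cone_class_def)
  show "iso_closed C (Cone_class C L)"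
    unfolding iso_closed_def Ball_def c using relatively_projective_iso[OF _ W(2)] by blast
  show "summand_closed C (Cone_class C L)"
    unfolding summand_closed_def Ball_def c
  proof (intro allI impI)
    fix P A B i j p q assume P: "relatively_projective C R P" and b: "biproduct C A B P i j p q"
    show "relatively_projective C R A"
      by (rule relatively_projective_retract[OF P W(2), of i p]) (use biproductD[OF b] in simp_all)
  qed
qed

text \<open>
  Factor \<open>0 \<rightarrow> X\<close> as \<open>0 \<rightarrow> U' \<rightarrow> X\<close>: the first factor puts \<open>U'\<close> into \<open>Cone(L)\<close>, and the second is a
  deflation with cocone in \<open>CoCone(R)\<close>.
\<close>

lemma admissible_wfs_resolution:
  assumes LR: "(L, R) \<in> admissible_wfs C" and X: "X \<in> obj C"
  shows "\<exists>x y. conflation C x y \<and> src C x \<in> CoCone_class C R \<and> tgt C x \<in> Cone_class C L \<and> tgt C y = X"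
proof -
  note W = admissible_wfsD[OF LR]
  obtain Z where Z: "zero_object C Z" "Z \<in> obj C" by (rule obtain_zero_object)
  obtain f g where fg: "f \<in> L" "g \<in> R" "tgt C f = src C g" "zero_mor C Z X = g \<cdot> f"
    using W(5)[of "zero_mor C Z X"] Z X by auto
  have a: "f \<in> arr C" "g \<in> arr C" using fg W by auto
  have s: "src C f = Z" "tgt C g = X"
    using arg_cong[OF fg(4), of "src C"] arg_cong[OF fg(4), of "tgt C"] a fg(3) Z X by simp_all
  have "f = zero_mor C Z (tgt C f)"
    by (rule from_zero_object[OF Z(1)]) (use a s Z in simp_all)
  hence "relatively_projective C R (tgt C f)"
    using zero_mor_in_left_lift_iff[OF Z(1) _ W(2), of "tgt C f"] fg(1) W(4) a by simp
  hence U: "tgt C f \<in> Cone_class C L" using Cone_class_iff_relatively_projective[OF LR] by simp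
  have "g \<in> Defl C (CoCone_class C R)" using fg(2) Defl_CoCone_class[OF LR] by simp
  then obtain x \<epsilon> where x: "realizes C x g (tgt C g) (src C x) \<epsilon>" "src C x \<in> CoCone_class C R"
    by (rule DeflE)
  show ?thesis using realizes_conflation[OF x(1)] x(2) U s(2) fg(3) realizesD(7)[OF x(1)] by metis
qed

text \<open>
  Orthogonality: a conflation \<open>B \<rightarrow> W \<rightarrow> A\<close> with \<open>B \<in> CoCone(R)\<close> and \<open>A \<in> Cone(L)\<close> has its deflation
  in \<open>R\<close>, through which the identity of \<open>A\<close> lifts.
\<close>

lemma admissible_wfs_cotorsion_pair:
  assumes LR: "(L, R) \<in> admissible_wfs C"
  shows "(Cone_class C L, CoCone_class C R) \<in> cotorsion_pairs C"
proof -
  note W = admissible_wfsD[OF LR] and op = admissible_wfs_opposite[OF LR]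
  have 1: "additive_subcategory C (CoCone_class C R)" "summand_closed C (CoCone_class C R)"
    "iso_closed (opposite C) (CoCone_class C R)"
    using extriangulated_category.Cone_class_subcategory[OF opposite_extriangulated op] by simp_all
  hence 2: "iso_closed C (CoCone_class C R)" by (simp add: iso_closed_def)
  have 3: "\<exists>x y. conflation C x y \<and> src C x = X \<and> tgt C x \<in> CoCone_class C R \<and> tgt C y \<in> Cone_class C L"
    if X: "X \<in> obj C" for X
    using extriangulated_category.admissible_wfs_resolution[OF opposite_extriangulated op, of X] X conflationE
    by simp metis
  have 4: "carrier (Ext C A B) = {\<one>\<^bsub>Ext C A B\<^esub>}" if AB: "A \<in> Cone_class C L" "B \<in> CoCone_class C R" for A B
  proof -
    have o: "A \<in> obj C" "B \<in> obj C" using AB by (auto simp: Cone_class_def CoCone_class_def)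
    have "\<theta> = \<one>\<^bsub>Ext C A B\<^esub>" if \<theta>: "\<theta> \<in> carrier (Ext C A B)" for \<theta>
    proof -
      obtain v w where vw: "realizes C v w A B \<theta>" using o \<theta> by (rule ex_realization)
      note D = realizesD[OF vw]
      have "w \<in> Defl C (CoCone_class C R)"
        using realizes_conflation[OF vw] D AB(2) by (intro DeflI[of v w]) simp_all
      hence "w \<in> R" using Defl_CoCone_class[OF LR] by simp
      moreover have "ident C A \<in> mor C A (tgt C w)" using o D by (simp add: mor_iff)
      ultimately obtain t where "t \<in> mor C A (src C w)" and wt: "w \<cdot> t = ident C A"
        using AB(1) Cone_class_iff_relatively_projective[OF LR] unfolding relatively_projective_def by blast
      hence t: "t \<in> arr C" "src C t = A" "tgt C t = src C w" by (simp_all add: mor_iff)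
      have "\<theta> = pull C B (w \<cdot> t) \<theta>" unfolding wt using o \<theta> by simp
      also have "\<dots> = pull C B t (pull C B w \<theta>)" by (rule pull_cmp) (use t D o in simp_all)
      also have "\<dots> = \<one>\<^bsub>Ext C A B\<^esub>" unfolding pull_deflation[OF vw] using t o D by simp
      finally show ?thesis .
    qed
    thus ?thesis using Ext_one_closed[OF o] by blast
  qed
  show ?thesis
    unfolding cotorsion_pairs_def
    using Cone_class_subcategory[OF LR] 1(1,2) 2 3 4 admissible_wfs_resolution[OF LR] by simp
qed

end

section \<open>The bijection\<close>

theorem theorem3p11:
  fixes C :: "('o, 'm, 'e, 'z) extri_scheme"
  assumes "extriangulated_category C"
    and "weakly_idempotent_complete C"
  defines "\<Phi> \<equiv> \<lambda>(U, V). (Infl C U, Defl C V)"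
    and "\<Psi> \<equiv> \<lambda>(L, R). (Cone_class C L, CoCone_class C R)"
  shows "bij_betw \<Phi> (cotorsion_pairs C) (admissible_wfs C) \<and>
    bij_betw \<Psi> (admissible_wfs C) (cotorsion_pairs C) \<and>
    (\<forall>p \<in> cotorsion_pairs C. \<Psi> (\<Phi> p) = p) \<and>
    (\<forall>q \<in> admissible_wfs C. \<Phi> (\<Psi> q) = q)"
proof -
  interpret extriangulated_category C by (rule assms(1))
  interpret wic_extriangulated_category C by (rule weakly_idempotent_complete_wic[OF assms(2)])
  have \<Phi>: "\<Phi> ` cotorsion_pairs C \<subseteq> admissible_wfs C"
    unfolding \<Phi>_def using cotorsion_pair_admissible_wfs by auto
  have \<Psi>: "\<Psi> ` admissible_wfs C \<subseteq> cotorsion_pairs C"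
    unfolding \<Psi>_def using admissible_wfs_cotorsion_pair by auto
  have 1: "\<forall>p \<in> cotorsion_pairs C. \<Psi> (\<Phi> p) = p"
    unfolding \<Phi>_def \<Psi>_def using Cone_class_Infl CoCone_class_Defl by auto
  have 2: "\<forall>q \<in> admissible_wfs C. \<Phi> (\<Psi> q) = q"
    unfolding \<Phi>_def \<Psi>_def using Infl_Cone_class Defl_CoCone_class by auto
  have "bij_betw \<Phi> (cotorsion_pairs C) (admissible_wfs C)"
    by (rule bij_betw_byWitness[OF 1 2 \<Phi> \<Psi>])
  moreover have "bij_betw \<Psi> (admissible_wfs C) (cotorsion_pairs C)"
    by (rule bij_betw_byWitness[OF 2 1 \<Psi> \<Phi>])
  ultimately show ?thesis using 1 2 by blast
qed

end
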